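(* Let $\mu_\Psi$ be the probability measure on $\mathbb{R}$ with density $\varphi(x)=Z_\Psi^{-1}\exp(-\Psi(|x|))$, where $\Psi:[0,\infty)\to[0,\infty)$ is convex, $\sqrt\Psi$ is concave, $\Psi(0)=0$, and $\Psi$ is $\mathcal{C}^2$ on $[\Psi^{-1}(1),+\infty)$; let $H(r)=\mu_\Psi(-\infty,r)$ and let $n\in\mathbb{N}$. Let $g:[0,1]\to[0,\infty)$ be such that $g>0$ a.e. and $$\sup_{0<t<1}g^*(t)\,\frac{\min\{t,1/2\}}{I_{\mu_\Psi}(\min\{t,1/2\})}<\infty,$$ where the rearrangement $g^*$ is taken with respect to Lebesgue measure on $[0,1]$. Let $w:\mathbb{R}^n\to\mathbb{R}^+$ be defined by $$w(x_1,\dots,x_n)=\frac{1}{g^*(H(x_1))}.$$ Then $w$ is an isoperimetric weight on $\mathbb{R}^n$ equipped with the Euclidean distance and the product probability measure $\mu_\Psi^{\otimes n}=\mu_\Psi\otimes\cdots\otimes\mu_\Psi$ ($n$ times).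
   Context: $Z_\Psi$ is the normalizing constant making $\mu_\Psi(\mathbb{R})=1$. The isoperimetric profile of $\mathbb{R}$ with the usual distance and $\mu_\Psi$ is $I_{\mu_\Psi}(t)=\varphi(H^{-1}(\min\{t,1-t\}))=\varphi(H^{-1}(t))$, $t\in[0,1]$ (value $0$ at $t=0,1$). Rearrangement. For measurable $g$ on $[0,1]$, $g^*(s)=\inf\{t\ge0: m\{|g|>t\}\le s\}$, where $m$ is Lebesgue measure. Isoperimetric weight. Let $(\Omega,\mu,d)$ be a metric measure space. For a Borel set $A$, $\mu^+(A)=\liminf_{h\to0}\frac{\mu(A_h)-\mu(A)}{h}$ with $A_h=\{x:d(x,A)<h\}$, and the isoperimetric profile is $I(t)=\inf\{\mu^+(A):\mu(A)=t\}$, $t\in[0,\mu(\Omega))$. A measurable $w:\Omega\to\mathbb{R}_+$ with $w>0$ a.e. is an isoperimetric weight if there is a constant $C=C(w)$ such that $$\frac{\min\{\mu(\{w\le r\}),\mu(\Omega)/2\}}{I(\min\{\mu(\{w\le r\}),\mu(\Omega)/2\})}\le Cr\quad\text{for all } r>0,$$ the quotient being read as $0$ when $\mu(\{w\le r\})=0$. Here $\Omega=\mathbb{R}^n$, $\mu=\mu_\Psi^{\otimes n}$ and $I=I_{\mu_\Psi^{\otimes n}}$. *)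

theory Defs
  imports "HOL-Probability.Probability"
begin

section \<open>Isoperimetry in metric measure spaces\<close>

text \<open>The condition \<open>A \<noteq> {}\<close> gives the convention \<open>d(x, {}) = \<infinity>\<close>; in the library
  \<^term>\<open>infdist x {}\<close> is \<open>0\<close>.\<close>

definition enlargement :: "'a::metric_space set \<Rightarrow> real \<Rightarrow> 'a set" where
  "enlargement A h = {x. A \<noteq> {} \<and> infdist x A < h}"

text \<open>Since \<open>A \<subseteq> enlargement A h\<close> for \<open>h > 0\<close>, the truncated subtraction of \<^typ>\<open>ennreal\<close> is the
  true difference whenever \<open>A\<close> has finite measure.\<close>

definition boundary_measure :: "'a::metric_space measure \<Rightarrow> 'a set \<Rightarrow> ennreal" where
  "boundary_measure M A =
     Liminf (at_right 0) (\<lambda>h. (emeasure M (enlargement A h) - emeasure M A) / ennreal h)"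

definition isoperimetric_profile :: "'a::metric_space measure \<Rightarrow> ennreal \<Rightarrow> ennreal" where
  "isoperimetric_profile M t =
     (INF A\<in>{A. A \<in> sets borel \<and> emeasure M A = t}. boundary_measure M A)"

text \<open>In \<^typ>\<open>ennreal\<close> one has \<open>0 / y = 0\<close> for every \<open>y\<close>, which is the required reading of the
  quotient when \<open>{w \<le> r}\<close> is a null set, and \<open>x / 0 = \<infinity>\<close> for \<open>x > 0\<close>, so that the inequality
  fails if the profile vanishes at a positive value.\<close>

definition isoperimetric_weight :: "'a::metric_space measure \<Rightarrow> ('a \<Rightarrow> real) \<Rightarrow> bool" where
  "isoperimetric_weight M w \<longleftrightarrow>
     w \<in> borel_measurable M \<and> (\<forall>x\<in>space M. 0 \<le> w x) \<and> (AE x in M. 0 < w x) \<and>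
     (\<exists>C::real. \<forall>r>0.
        (let m = min (emeasure M {x \<in> space M. w x \<le> r}) (emeasure M (space M) / 2)
         in m / isoperimetric_profile M m \<le> ennreal (C * r)))"

section \<open>Rearrangement\<close>

text \<open>The set below is nonempty for \<open>s > 0\<close>. At \<open>s = 0\<close> it is empty if \<open>g\<close> is essentially
  unbounded, and the value (conventionally \<open>\<infinity>\<close>) is then meaningless.\<close>

definition rearrangement :: "(real \<Rightarrow> real) \<Rightarrow> real \<Rightarrow> real" where
  "rearrangement g s =
     Inf {t. 0 \<le> t \<and> measure (lebesgue_on {0..1}) {x\<in>{0..1}. \<bar>g x\<bar> > t} \<le> s}"

section \<open>The measures\<close>

definition norm_const :: "(real \<Rightarrow> real) \<Rightarrow> real" where
  "norm_const \<Psi> = (\<integral>x. exp (- \<Psi> \<bar>x\<bar>) \<partial>lborel)"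

definition mu :: "(real \<Rightarrow> real) \<Rightarrow> real measure" where
  "mu \<Psi> = density lborel (\<lambda>x. ennreal (exp (- \<Psi> \<bar>x\<bar>) / norm_const \<Psi>))"

definition H :: "(real \<Rightarrow> real) \<Rightarrow> real \<Rightarrow> real" where
  "H \<Psi> r = measure (mu \<Psi>) {..<r}"

text \<open>The product measure lives on functions \<open>'n \<Rightarrow> real\<close>; it is transported to \<^typ>\<open>real ^ 'n\<close>,
  whose \<^const>\<open>dist\<close> is the Euclidean distance.\<close>

definition mu_prod :: "(real \<Rightarrow> real) \<Rightarrow> (real ^ 'n) measure" where
  "mu_prod \<Psi> = distr (\<Pi>\<^sub>M i\<in>UNIV. mu \<Psi>) borel (\<lambda>f. \<chi> i. f i)"

section \<open>Regularity\<close>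

text \<open>At a boundary point of \<open>S\<close> the derivatives are one-sided.\<close>

definition C2_on :: "real set \<Rightarrow> (real \<Rightarrow> real) \<Rightarrow> bool" where
  "C2_on S f \<longleftrightarrow> (\<exists>f' f''.
     (\<forall>x\<in>S. (f has_real_derivative f' x) (at x within S)) \<and>
     (\<forall>x\<in>S. (f' has_real_derivative f'' x) (at x within S)) \<and>
     continuous_on S f'')"

end

theory Submission
  imports Defs
begin

text \<open>Write \<open>T x\<close> for the measure of \<open>[x, \<infinity>)\<close> and \<open>r = \<phi> / T\<close> for the hazard rate, which is nondecreasing
  on \<open>[0, \<infinity>)\<close> because \<open>\<Psi>\<close> is convex. Half-lines show that the profile of \<open>\<mu>\<^sub>\<Psi>\<close> at \<open>T q\<close> is at most
  \<open>\<phi> q\<close>, and \<open>w\<close> depends on one coordinate only, so everything reduces to the existence of a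
  constant \<open>c > 0\<close>, depending on \<open>n\<close> and \<open>\<Psi>\<close>, such that the profile of the product measure at
  \<open>T y \<le> 1/2\<close> is at least \<open>c * \<phi> y\<close>.

  On the line, let \<open>B\<close> have measure \<open>a\<close>, put \<open>b = min a (1 - a)\<close> and let \<open>T q = b/4\<close>. The interval
  \<open>[-q, q]\<close> meets \<open>B\<close> and has measure at least \<open>a + b/2\<close>; hence either \<open>B\<^sub>h\<close> covers it, or
  \<open>B\<^sub>h - B\<close> contains an interval of length \<open>h\<close> inside it, whose measure is at least \<open>h * \<phi> q\<close>.
  Integrating over all lines parallel to an axis bounds \<open>\<mu>(A\<^sub>h) - \<mu>(A)\<close> below in terms of the measures
  of the one-dimensional sections of \<open>A\<close>. If \<open>\<mu>(A) = t\<close> is bounded away from \<open>0\<close>, the Efron--Stein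
  inequality finishes the proof. If \<open>t\<close> is small, a weak Loomis--Whitney inequality shows that on half
  of \<open>A\<close> some section has measure at most \<open>T x\<close>, where \<open>t = \<kappa> * T x ^ n\<close>. Finally, concavity of
  \<open>\<surd>\<Psi>\<close> keeps the hazard rate at \<open>y\<close>, where \<open>T y = t\<close>, within a constant factor of the one at \<open>x\<close>.\<close>

section \<open>Averages over one coordinate in product spaces\<close>

text \<open>For the indicator of a set this is the measure of the section through \<open>x\<close>
  parallel to axis \<open>i\<close>. The value does not depend on \<open>x i\<close>.\<close>

definition coord_avg :: "'a measure \<Rightarrow> 'i \<Rightarrow> (('i \<Rightarrow> 'a) \<Rightarrow> ennreal) \<Rightarrow> ('i \<Rightarrow> 'a) \<Rightarrow> ennreal" where
  "coord_avg M i f x = (\<integral>\<^sup>+ s. f (x(i := s)) \<partial>M)"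

context prob_space
begin

lemma coord_avg_measurable [measurable]:
  assumes [measurable]: "f \<in> borel_measurable (Pi\<^sub>M I (\<lambda>_. M))" and i: "i \<in> I"
  shows "coord_avg M i f \<in> borel_measurable (Pi\<^sub>M I (\<lambda>_. M))"
proof -
  have "(\<lambda>p. (fst p)(i := snd p)) \<in> Pi\<^sub>M I (\<lambda>_. M) \<Otimes>\<^sub>M M \<rightarrow>\<^sub>M Pi\<^sub>M I (\<lambda>_. M)"
    using i by (intro measurable_fun_upd[where J = I]) auto
  from measurable_compose[OF this assms(1)]
  have "(\<lambda>(x, s). f (x(i := s))) \<in> borel_measurable (Pi\<^sub>M I (\<lambda>_. M) \<Otimes>\<^sub>M M)"
    by (simp add: case_prod_beta')
  then show ?thesis
    unfolding coord_avg_def[abs_def] by measurable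
qed

lemma measurable_upd:
  assumes "y \<in> space M" "i \<notin> I"
  shows "(\<lambda>x. x(i := y)) \<in> Pi\<^sub>M I (\<lambda>_. M) \<rightarrow>\<^sub>M Pi\<^sub>M (insert i I) (\<lambda>_. M)"
  using assms by (intro measurable_fun_upd[where J = I]) auto

lemma measurable_upd_pair:
  "(\<lambda>p. (snd p)(i := fst p)) \<in> M \<Otimes>\<^sub>M Pi\<^sub>M I (\<lambda>_. M) \<rightarrow>\<^sub>M Pi\<^sub>M (insert i I) (\<lambda>_. M)"
  by (intro measurable_fun_upd[where J = I]) auto

lemma product_sigma_finite_const: "product_sigma_finite (\<lambda>_::'i. M)"
  by (simp add: product_sigma_finite_def sigma_finite_measure_axioms)

lemmas nn_integral_insert = product_sigma_finite.product_nn_integral_insert[OF product_sigma_finite_const]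
lemmas nn_integral_insert_rev = product_sigma_finite.product_nn_integral_insert_rev[OF product_sigma_finite_const]

lemma prob_space_PiM_const: "prob_space (Pi\<^sub>M I (\<lambda>_. M))"
  by (intro prob_space_PiM prob_space_axioms)

lemma nn_integral_coord_avg:
  assumes [measurable]: "f \<in> borel_measurable (Pi\<^sub>M I (\<lambda>_. M))" and i: "i \<in> I" and I: "finite I"
  shows "(\<integral>\<^sup>+ x. coord_avg M i f x \<partial>Pi\<^sub>M I (\<lambda>_. M)) = (\<integral>\<^sup>+ x. f x \<partial>Pi\<^sub>M I (\<lambda>_. M))"
proof -
  define J where "J = I - {i}"
  have J: "I = insert i J" "i \<notin> J" "finite J" using i I by (auto simp: J_def)
  have m: "f \<in> borel_measurable (Pi\<^sub>M (insert i J) (\<lambda>_. M))" using assms(1) J by simp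
  have ma: "coord_avg M i f \<in> borel_measurable (Pi\<^sub>M (insert i J) (\<lambda>_. M))"
    using coord_avg_measurable[OF m] by simp
  show ?thesis
    unfolding J(1) nn_integral_insert[OF J(3,2) m] nn_integral_insert[OF J(3,2) ma]
    by (simp add: coord_avg_def emeasure_space_1)
qed

text \<open>The factor \<open>g\<close> is constant in coordinate \<open>i\<close> and can be moved
  under the average. In this sense \<open>coord_avg\<close> acts as a conditional
  expectation.\<close>

lemma nn_integral_mult_coord_avg:
  assumes f[measurable]: "f \<in> borel_measurable (Pi\<^sub>M I (\<lambda>_. M))"
    and g: "\<And>x s. g (x(i := s)) = g x"
    and [measurable]: "g \<in> borel_measurable (Pi\<^sub>M I (\<lambda>_. M))" and i: "i \<in> I" and I: "finite I"
  shows "(\<integral>\<^sup>+ x. coord_avg M i f x * g x \<partial>Pi\<^sub>M I (\<lambda>_. M)) = (\<integral>\<^sup>+ x. f x * g x \<partial>Pi\<^sub>M I (\<lambda>_. M))"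
proof -
  have mx: "(\<lambda>s. f (x(i := s))) \<in> borel_measurable M" if "x \<in> space (Pi\<^sub>M I (\<lambda>_. M))" for x
    using that i by (intro measurable_compose[OF _ f] measurable_fun_upd[where J = I]) auto
  have "(\<integral>\<^sup>+ x. coord_avg M i f x * g x \<partial>Pi\<^sub>M I (\<lambda>_. M)) =
      (\<integral>\<^sup>+ x. coord_avg M i (\<lambda>x. f x * g x) x \<partial>Pi\<^sub>M I (\<lambda>_. M))"
    by (intro nn_integral_cong) (simp add: coord_avg_def g nn_integral_multc mx)
  also have "\<dots> = (\<integral>\<^sup>+ x. f x * g x \<partial>Pi\<^sub>M I (\<lambda>_. M))"
    using i I by (intro nn_integral_coord_avg) auto
  finally show ?thesis .
qed

lemma coord_avg_upd_same: "coord_avg M i f (x(i := s)) = coord_avg M i f x"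
  by (simp add: coord_avg_def)

lemma coord_avg_upd_other:
  "i \<noteq> j \<Longrightarrow> coord_avg M j (\<lambda>x. f (x(i := y))) x = coord_avg M j f (x(i := y))"
  by (simp add: coord_avg_def fun_upd_twist)

lemma measurable_section:
  assumes [measurable]: "f \<in> borel_measurable (Pi\<^sub>M (insert i I) (\<lambda>_. M))"
    and "y \<in> space M" "i \<notin> I"
  shows "(\<lambda>x. f (x(i := y))) \<in> borel_measurable (Pi\<^sub>M I (\<lambda>_. M))"
  by (rule measurable_compose[OF measurable_upd assms(1)]) (use assms in auto)

lemma space_upd:
  assumes "x \<in> space (Pi\<^sub>M I (\<lambda>_. M))" "y \<in> space M"
  shows "x(i := y) \<in> space (Pi\<^sub>M (insert i I) (\<lambda>_. M))"
  using assms by (auto simp: space_PiM PiE_def extensional_def)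

lemma nn_integral_le_1:
  assumes "\<And>x. x \<in> space M \<Longrightarrow> f x \<le> (1::ennreal)"
  shows "(\<integral>\<^sup>+ x. f x \<partial>M) \<le> 1"
proof -
  have "(\<integral>\<^sup>+ x. f x \<partial>M) \<le> (\<integral>\<^sup>+ x. 1 \<partial>M)" using assms by (intro nn_integral_mono)
  then show ?thesis by (simp add: emeasure_space_1)
qed

text \<open>A weak form of the Loomis--Whitney inequality. A point of the exceptional set whose section
  orthogonal to \<open>i\<close> is small is exceptional for that section; the others are counted by Markov's
  inequality in both factors.\<close>

lemma small_average_of_small_integral:
  fixes I :: "'i set"
  assumes "finite I"
  shows "0 < \<epsilon> \<Longrightarrow> \<exists>\<kappa>>0. \<forall>f s. f \<in> borel_measurable (Pi\<^sub>M I (\<lambda>_. M)) \<longrightarrow>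
    (\<forall>x\<in>space (Pi\<^sub>M I (\<lambda>_. M)). f x = 0 \<or> f x = 1) \<longrightarrow> 0 < s \<longrightarrow>
    (\<integral>\<^sup>+ x. f x \<partial>Pi\<^sub>M I (\<lambda>_. M)) \<le> ennreal (\<kappa> * s ^ card I) \<longrightarrow>
    (\<integral>\<^sup>+ x. f x * indicator {x. \<forall>i\<in>I. ennreal s < coord_avg M i f x} x \<partial>Pi\<^sub>M I (\<lambda>_. M))
      \<le> ennreal \<epsilon> * (\<integral>\<^sup>+ x. f x \<partial>Pi\<^sub>M I (\<lambda>_. M))"
  using assms
proof (induction I arbitrary: \<epsilon> rule: finite_induct)
  case empty
  have P: "(\<integral>\<^sup>+ x. f x \<partial>Pi\<^sub>M {} (\<lambda>_. M)) = f (\<lambda>_. undefined)" for f :: "('i \<Rightarrow> 'a) \<Rightarrow> ennreal"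
    by (simp add: PiM_empty nn_integral_count_space_finite)
  show ?case
  \<comment> \<open>With no coordinates the exceptional set is everything, so \<open>f\<close> must
    vanish at the only point of the space. The power of \<open>s\<close> is 1, and a constant below
    1 excludes the value 1.\<close>
  proof (intro exI[of _ "1/2"] conjI allI impI)
    fix f :: "('i \<Rightarrow> 'a) \<Rightarrow> ennreal" and s :: real
    assume f01: "\<forall>x\<in>space (Pi\<^sub>M {} (\<lambda>_. M)). f x = 0 \<or> f x = 1"
      and le: "(\<integral>\<^sup>+ x. f x \<partial>Pi\<^sub>M {} (\<lambda>_. M)) \<le> ennreal (1/2 * s ^ card ({}::'i set))"
    have "f (\<lambda>_. undefined) = 0"
    proof (rule ccontr)
      assume "f (\<lambda>_. undefined) \<noteq> 0"
      then have "f (\<lambda>_. undefined) = 1" using f01 by (auto simp: space_PiM)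
      then have "ennreal 1 \<le> ennreal (1/2)" using le unfolding P by simp
      then show False by (subst (asm) ennreal_le_iff) auto
    qed
    then show "(\<integral>\<^sup>+ x. f x * indicator {x. \<forall>i\<in>{}. ennreal s < coord_avg M i f x} x \<partial>Pi\<^sub>M {} (\<lambda>_. M))
      \<le> ennreal \<epsilon> * (\<integral>\<^sup>+ x. f x \<partial>Pi\<^sub>M {} (\<lambda>_. M))"
      unfolding P by simp
  qed simp
next
  case (insert i I)
  let ?P = "Pi\<^sub>M I (\<lambda>_. M)" and ?Q = "Pi\<^sub>M (insert i I) (\<lambda>_. M)"
  interpret P: prob_space ?P by (rule prob_space_PiM_const)
  \<comment> \<open>Half of the error is reserved for the light slices, which are left to the
    induction hypothesis, the other half for the heavy ones.\<close>
  have "0 < \<epsilon> / 2" using insert by simp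
  from insert.IH[OF this] obtain \<kappa> where k: "0 < \<kappa>" and
    IH: "\<And>f s. f \<in> borel_measurable ?P \<Longrightarrow>
    \<forall>x\<in>space ?P. f x = 0 \<or> f x = 1 \<Longrightarrow> 0 < s \<Longrightarrow>
    (\<integral>\<^sup>+ x. f x \<partial>?P) \<le> ennreal (\<kappa> * s ^ card I) \<Longrightarrow>
    (\<integral>\<^sup>+ x. f x * indicator {x. \<forall>i\<in>I. ennreal s < coord_avg M i f x} x \<partial>?P)
      \<le> ennreal (\<epsilon> / 2) * (\<integral>\<^sup>+ x. f x \<partial>?P)"
    by blast
  show ?case
  \<comment> \<open>With this constant the total mass \<open>t\<close> is at most
    \<open>\<epsilon> / 2 * (th * s)\<close>, which is what turns the quadratic error
    \<open>t * t / (th * s)\<close> below into \<open>\<epsilon> / 2 * t\<close>.\<close>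
  proof (intro exI[of _ "\<epsilon> / 2 * \<kappa>"] conjI allI impI)
    fix f :: "('i \<Rightarrow> 'a) \<Rightarrow> ennreal" and s :: real
    assume f[measurable]: "f \<in> borel_measurable ?Q"
      and f01: "\<forall>x\<in>space ?Q. f x = 0 \<or> f x = 1" and s: "0 < s"
      and le: "(\<integral>\<^sup>+ x. f x \<partial>?Q) \<le> ennreal (\<epsilon> / 2 * \<kappa> * s ^ card (insert i I))"
    \<comment> \<open>\<open>b\<close> measures the line sections in direction \<open>i\<close> and
      \<open>p\<close> the slices orthogonal to it; \<open>th\<close> is the slice mass up to which
      the induction hypothesis applies.\<close>
    define b where "b = coord_avg M i f"
    define p where "p = (\<lambda>y. \<integral>\<^sup>+ x. f (x(i := y)) \<partial>?P)"
    define th where "th = \<kappa> * s ^ card I"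
    have th: "0 < th" using k s by (simp add: th_def)
    have b[measurable]: "b \<in> borel_measurable ?Q" unfolding b_def by measurable
    have p[measurable]: "p \<in> borel_measurable M"
    proof -
      have "(\<lambda>(y, x). f (x(i := y))) \<in> borel_measurable (M \<Otimes>\<^sub>M ?P)"
        using measurable_compose[OF measurable_upd_pair f] by (simp add: case_prod_beta')
      then show ?thesis unfolding p_def by (rule P.borel_measurable_nn_integral)
    qed
    let ?G = "{x. \<forall>j\<in>insert i I. ennreal s < coord_avg M j f x}"
    have meas_avg: "coord_avg M j f \<in> borel_measurable ?Q" if "j \<in> insert i I" for j
      using that by (rule coord_avg_measurable[OF f])
    have G: "(\<lambda>x. indicator ?G x :: ennreal) \<in> borel_measurable ?Q"
    proof -
      have "(\<lambda>x. indicator ?G x :: ennreal) \<in> borel_measurable ?Q \<longleftrightarrow>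
         (\<lambda>x. \<Prod>j\<in>insert i I. (if ennreal s < coord_avg M j f x then 1 else 0) :: ennreal) \<in> borel_measurable ?Q"
        using insert.hyps by (intro measurable_cong) (auto simp: indicator_def)
      also have "\<dots>"
      proof (intro borel_measurable_prod_ennreal)
        fix j assume "j \<in> insert i I"
        note [measurable] = meas_avg[OF this]
        show "(\<lambda>x. if ennreal s < coord_avg M j f x then 1 else 0 :: ennreal) \<in> borel_measurable ?Q"
          by measurable
      qed
      finally show ?thesis .
    qed
    \<comment> \<open>A slice of mass at most \<open>th\<close> is covered by the first term. On a
      heavier one, \<open>p y / th\<close> exceeds 1, and so does \<open>b / s\<close> on
      \<open>?G\<close>; the product of the two then dominates the indicator.\<close>
    have inner: "(\<integral>\<^sup>+ x. f (x(i := y)) * indicator ?G (x(i := y)) \<partial>?P) \<le>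
        ennreal (\<epsilon> / 2) * p y + ennreal (1 / (th * s)) * (\<integral>\<^sup>+ x. f (x(i := y)) * b (x(i := y)) * p y \<partial>?P)"
      (is "?L \<le> ?R1 + ?R2") if y: "y \<in> space M" for y
    proof (cases "p y \<le> ennreal th")
      case True
      have "?L \<le> (\<integral>\<^sup>+ x. f (x(i := y)) * indicator {x. \<forall>j\<in>I. ennreal s < coord_avg M j (\<lambda>x. f (x(i := y))) x} x \<partial>?P)"
      proof (intro nn_integral_mono mult_left_mono)
        fix x
        have "coord_avg M j (\<lambda>x. f (x(i := y))) x = coord_avg M j f (x(i := y))" if "j \<in> I" for j
          using that insert.hyps by (intro coord_avg_upd_other) auto
        then show "indicator ?G (x(i := y)) \<le> (indicator {x. \<forall>j\<in>I. ennreal s < coord_avg M j (\<lambda>x. f (x(i := y))) x} x :: ennreal)"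
          by (auto simp: indicator_def)
      qed simp
      also have "\<dots> \<le> ?R1"
        unfolding p_def using y s insert.hyps True f01
        by (intro IH measurable_section) (auto simp: p_def th_def space_upd)
      finally show ?thesis by (simp add: add_increasing2)
    next
      case False
      have "f (x(i := y)) * indicator ?G (x(i := y)) \<le>
          ennreal (1 / (th * s)) * (f (x(i := y)) * b (x(i := y)) * p y)" for x
      proof (cases "x(i := y) \<in> ?G")
        case True
        then have "ennreal s \<le> b (x(i := y))" by (auto simp: b_def intro: less_imp_le)
        then have "ennreal s * ennreal th \<le> b (x(i := y)) * p y"
          using False by (intro mult_mono) auto
        then have "ennreal (1 / (th * s)) * (ennreal s * ennreal th) \<le> ennreal (1 / (th * s)) * (b (x(i := y)) * p y)"
          by (rule mult_left_mono) simp
        also have "ennreal (1 / (th * s)) * (ennreal s * ennreal th) = 1"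
          using th s by (simp flip: ennreal_mult)
        finally have "1 \<le> ennreal (1 / (th * s)) * (b (x(i := y)) * p y)" .
        then have "f (x(i := y)) * 1 \<le> f (x(i := y)) * (ennreal (1 / (th * s)) * (b (x(i := y)) * p y))"
          by (rule mult_left_mono) simp
        then show ?thesis using True by (simp add: ac_simps)
      qed simp
      then have "?L \<le> (\<integral>\<^sup>+ x. ennreal (1 / (th * s)) * (f (x(i := y)) * b (x(i := y)) * p y) \<partial>?P)"
        by (intro nn_integral_mono)
      also have "\<dots> = ?R2"
        using measurable_section[OF f y] measurable_section[OF b y] insert.hyps
        by (intro nn_integral_cmult) auto
      finally show ?thesis by (simp add: add_increasing)
    qed
    define t where "t = (\<integral>\<^sup>+ x. f x \<partial>?Q)"
    have t_p: "t = (\<integral>\<^sup>+ y. p y \<partial>M)"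
      unfolding t_def p_def by (rule nn_integral_insert_rev) (use insert.hyps in auto)
    let ?F = "\<lambda>x. f x * b x * p (x i)"
    have F[measurable]: "?F \<in> borel_measurable ?Q" by measurable
    have meas2: "(\<lambda>y. \<integral>\<^sup>+ x. f (x(i := y)) * b (x(i := y)) * p y \<partial>?P) \<in> borel_measurable M"
    proof -
      have "(\<lambda>(y, x). ?F (x(i := y))) \<in> borel_measurable (M \<Otimes>\<^sub>M ?P)"
        using measurable_compose[OF measurable_upd_pair F] by (simp add: case_prod_beta')
      from P.borel_measurable_nn_integral[OF this] show ?thesis by simp
    qed
    have "(\<integral>\<^sup>+ y. (\<integral>\<^sup>+ x. f (x(i := y)) * b (x(i := y)) * p y \<partial>?P) \<partial>M) = (\<integral>\<^sup>+ x. ?F x \<partial>?Q)"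
      using insert.hyps by (subst nn_integral_insert_rev) auto
    also have "\<dots> = (\<integral>\<^sup>+ x. (\<integral>\<^sup>+ y. ?F (x(i := y)) \<partial>M) \<partial>?P)"
      using insert.hyps by (intro nn_integral_insert) auto
    \<comment> \<open>Dropping one factor \<open>f \<le> 1\<close> decouples \<open>b\<close>, which
      is constant in direction \<open>i\<close>, from \<open>p\<close>, which depends on that
      direction only. Each of them integrates to \<open>t\<close>.\<close>
    also have "\<dots> \<le> (\<integral>\<^sup>+ x. b x * t \<partial>?P)"
    proof (intro nn_integral_mono)
      fix x assume x: "x \<in> space ?P"
      have "(\<integral>\<^sup>+ y. ?F (x(i := y)) \<partial>M) = (\<integral>\<^sup>+ y. b x * (f (x(i := y)) * p y) \<partial>M)"
        by (intro nn_integral_cong) (simp add: b_def coord_avg_upd_same ac_simps)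
      also have "\<dots> \<le> (\<integral>\<^sup>+ y. b x * p y \<partial>M)"
      proof (intro nn_integral_mono mult_left_mono)
        fix y assume "y \<in> space M"
        then have "f (x(i := y)) \<le> 1" using f01 space_upd[OF x] by fastforce
        then show "f (x(i := y)) * p y \<le> p y" using mult_right_mono[of "f (x(i := y))" 1 "p y"] by simp
      qed simp
      also have "\<dots> = b x * t" by (simp add: nn_integral_cmult t_p)
      finally show "(\<integral>\<^sup>+ y. ?F (x(i := y)) \<partial>M) \<le> b x * t" .
    qed
    also have "\<dots> = (\<integral>\<^sup>+ x. (\<integral>\<^sup>+ y. b (x(i := y)) * t \<partial>M) \<partial>?P)"
      by (simp add: b_def coord_avg_upd_same emeasure_space_1)
    also have "\<dots> = (\<integral>\<^sup>+ x. b x * t \<partial>?Q)"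
      using insert.hyps by (intro nn_integral_insert[symmetric]) auto
    also have "\<dots> = t * t"
      using insert.hyps by (simp add: nn_integral_multc b_def nn_integral_coord_avg t_def)
    finally have second: "(\<integral>\<^sup>+ y. (\<integral>\<^sup>+ x. f (x(i := y)) * b (x(i := y)) * p y \<partial>?P) \<partial>M) \<le> t * t" .
    have "(\<integral>\<^sup>+ x. f x * indicator ?G x \<partial>?Q) = (\<integral>\<^sup>+ y. (\<integral>\<^sup>+ x. f (x(i := y)) * indicator ?G (x(i := y)) \<partial>?P) \<partial>M)"
      using insert.hyps G by (intro nn_integral_insert_rev) auto
    also have "\<dots> \<le> (\<integral>\<^sup>+ y. ennreal (\<epsilon> / 2) * p y + ennreal (1 / (th * s)) * (\<integral>\<^sup>+ x. f (x(i := y)) * b (x(i := y)) * p y \<partial>?P) \<partial>M)"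
      by (intro nn_integral_mono inner)
    also have "\<dots> = ennreal (\<epsilon> / 2) * t + ennreal (1 / (th * s)) * (\<integral>\<^sup>+ y. (\<integral>\<^sup>+ x. f (x(i := y)) * b (x(i := y)) * p y \<partial>?P) \<partial>M)"
      using meas2 by (simp add: nn_integral_add nn_integral_cmult t_p)
    also have "\<dots> \<le> ennreal (\<epsilon> / 2) * t + ennreal (1 / (th * s)) * (t * t)"
      using second by (intro add_left_mono mult_left_mono) auto
    also have "\<dots> \<le> ennreal (\<epsilon> / 2) * t + ennreal (\<epsilon> / 2) * t"
    proof -
      have "\<epsilon> / 2 * \<kappa> * s ^ card (insert i I) = \<epsilon> / 2 * (th * s)"
        using insert.hyps by (simp add: th_def)
      with le have "t \<le> ennreal (\<epsilon> / 2 * (th * s))" by (simp only: t_def)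
      then have "ennreal (1 / (th * s)) * t \<le> ennreal (1 / (th * s)) * ennreal (\<epsilon> / 2 * (th * s))"
        by (rule mult_left_mono) simp
      also have "\<dots> = ennreal (\<epsilon> / 2)"
        using th s insert.prems by (simp flip: ennreal_mult)
      finally have "ennreal (1 / (th * s)) * t * t \<le> ennreal (\<epsilon> / 2) * t" by (rule mult_right_mono) simp
      then show ?thesis by (intro add_left_mono) (simp add: ac_simps)
    qed
    also have "\<dots> = ennreal \<epsilon> * t"
      using insert.prems by (simp flip: distrib_right ennreal_plus)
    finally show "(\<integral>\<^sup>+ x. f x * indicator ?G x \<partial>?Q) \<le> ennreal \<epsilon> * (\<integral>\<^sup>+ x. f x \<partial>?Q)"
      by (simp add: t_def)
  qed (use k insert.prems in simp)
qed

text \<open>Passing from a point of a set to an independent point of its complement one coordinate at a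
  time, some coordinate change must leave the set.\<close>

lemma variance_le_sum_coord_avg:
  fixes I :: "'i set"
  assumes "finite I"
  shows "f \<in> borel_measurable (Pi\<^sub>M I (\<lambda>_. M)) \<Longrightarrow> g \<in> borel_measurable (Pi\<^sub>M I (\<lambda>_. M)) \<Longrightarrow>
    (\<And>x. x \<in> space (Pi\<^sub>M I (\<lambda>_. M)) \<Longrightarrow> (f x = 1 \<and> g x = 0) \<or> (f x = 0 \<and> g x = 1)) \<Longrightarrow>
    (\<integral>\<^sup>+ x. f x \<partial>Pi\<^sub>M I (\<lambda>_. M)) * (\<integral>\<^sup>+ x. g x \<partial>Pi\<^sub>M I (\<lambda>_. M)) \<le>
    (\<Sum>i\<in>I. \<integral>\<^sup>+ x. coord_avg M i f x * coord_avg M i g x \<partial>Pi\<^sub>M I (\<lambda>_. M))"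
  using assms
proof (induction I arbitrary: f g rule: finite_induct)
  case empty
  have P: "(\<integral>\<^sup>+ x. f x \<partial>Pi\<^sub>M {} (\<lambda>_. M)) = f (\<lambda>_. undefined)" for f :: "('i \<Rightarrow> 'a) \<Rightarrow> ennreal"
    by (simp add: PiM_empty nn_integral_count_space_finite)
  show ?case using empty.prems(3)[of "\<lambda>_. undefined"] unfolding P by (auto simp: space_PiM)
next
  case (insert i I)
  let ?P = "Pi\<^sub>M I (\<lambda>_. M)" and ?Q = "Pi\<^sub>M (insert i I) (\<lambda>_. M)"
  interpret P: prob_space ?P by (rule prob_space_PiM_const)
  note f[measurable] = insert.prems(1) and g[measurable] = insert.prems(2) and fg = insert.prems(3)
  have pair: "(\<lambda>(y, x). h (x(i := y))) \<in> borel_measurable (M \<Otimes>\<^sub>M ?P)"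
    if "h \<in> borel_measurable ?Q" for h :: "_ \<Rightarrow> ennreal"
    using measurable_compose[OF measurable_upd_pair that] by (simp add: case_prod_beta')
  have [measurable]: "coord_avg M i f \<in> borel_measurable ?Q" "coord_avg M i g \<in> borel_measurable ?Q"
    by (auto intro: coord_avg_measurable)
  define p where "p = (\<lambda>y. \<integral>\<^sup>+ x. f (x(i := y)) \<partial>?P)"
  define q where "q = (\<lambda>y. \<integral>\<^sup>+ x. g (x(i := y)) \<partial>?P)"
  have [measurable]: "p \<in> borel_measurable M" "q \<in> borel_measurable M"
    unfolding p_def q_def by (auto intro!: P.borel_measurable_nn_integral pair)
  \<comment> \<open>\<open>B\<close> ignores coordinate \<open>i\<close>, so its integral over any
    slice is the full mass \<open>T\<close> of \<open>g\<close>. This brings \<open>T\<close> into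
    an estimate on a single slice.\<close>
  define B where "B = coord_avg M i g"
  have [measurable]: "B \<in> borel_measurable ?Q" unfolding B_def by measurable
  define T where "T = (\<integral>\<^sup>+ x. g x \<partial>?Q)"
  have B_P: "(\<integral>\<^sup>+ x. B (x(i := y)) \<partial>?P) = T" for y
  proof -
    have "(\<integral>\<^sup>+ x. B (x(i := y)) \<partial>?P) = (\<integral>\<^sup>+ x. (\<integral>\<^sup>+ y. g (x(i := y)) \<partial>M) \<partial>?P)"
      by (simp add: B_def coord_avg_upd_same coord_avg_def)
    also have "\<dots> = T"
      unfolding T_def using insert.hyps by (intro nn_integral_insert[symmetric]) auto
    finally show ?thesis .
  qed
  \<comment> \<open>Pointwise on the slice, \<open>p y * B\<close> is at most \<open>p y\<close>
    where \<open>g = 1\<close> and at most \<open>B\<close> where \<open>f = 1\<close>. Integration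
    leaves \<open>p y * q y\<close>, to which the induction hypothesis applies, and the integral of
    \<open>f * B\<close>, which is the contribution of direction \<open>i\<close>.\<close>
  have key: "p y * T \<le> (\<Sum>j\<in>I. \<integral>\<^sup>+ x. coord_avg M j f (x(i := y)) * coord_avg M j g (x(i := y)) \<partial>?P)
      + (\<integral>\<^sup>+ x. f (x(i := y)) * B (x(i := y)) \<partial>?P)" if y: "y \<in> space M" for y
  proof -
    note [measurable] = measurable_section[OF f y insert.hyps(2)] measurable_section[OF g y insert.hyps(2)]
      measurable_section[OF \<open>B \<in> borel_measurable ?Q\<close> y insert.hyps(2)]
    have p1: "p y \<le> 1"
      unfolding p_def using fg space_upd[OF _ y] by (intro P.nn_integral_le_1) fastforce
    have "p y * T = (\<integral>\<^sup>+ x. p y * B (x(i := y)) \<partial>?P)"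
      by (subst nn_integral_cmult) (auto simp: B_P)
    also have "\<dots> \<le> (\<integral>\<^sup>+ x. p y * g (x(i := y)) + f (x(i := y)) * B (x(i := y)) \<partial>?P)"
    proof (intro nn_integral_mono)
      fix x assume x: "x \<in> space ?P"
      have B1: "B (x(i := y)) \<le> 1"
        unfolding B_def coord_avg_def using fg space_upd[OF x] by (intro nn_integral_le_1) fastforce
      consider "f (x(i := y)) = 1" "g (x(i := y)) = 0" | "f (x(i := y)) = 0" "g (x(i := y)) = 1"
        using fg[OF space_upd[OF x y]] by blast
      then show "p y * B (x(i := y)) \<le> p y * g (x(i := y)) + f (x(i := y)) * B (x(i := y))"
      proof cases
        case 1 then show ?thesis using mult_right_mono[OF p1, of "B (x(i := y))"] by simp
      next
        case 2 then show ?thesis using mult_left_mono[OF B1, of "p y"] by simp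
      qed
    qed
    also have "\<dots> = p y * q y + (\<integral>\<^sup>+ x. f (x(i := y)) * B (x(i := y)) \<partial>?P)"
      by (subst nn_integral_add) (auto simp: nn_integral_cmult q_def)
    finally have 1: "p y * T \<le> p y * q y + (\<integral>\<^sup>+ x. f (x(i := y)) * B (x(i := y)) \<partial>?P)" .
    have "p y * q y \<le> (\<Sum>j\<in>I. \<integral>\<^sup>+ x. coord_avg M j (\<lambda>x. f (x(i := y))) x * coord_avg M j (\<lambda>x. g (x(i := y))) x \<partial>?P)"
      unfolding p_def q_def by (intro insert.IH fg space_upd[OF _ y] measurable_section[OF f y] measurable_section[OF g y] insert.hyps)
    also have "\<dots> = (\<Sum>j\<in>I. \<integral>\<^sup>+ x. coord_avg M j f (x(i := y)) * coord_avg M j g (x(i := y)) \<partial>?P)"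
      using insert.hyps by (intro sum.cong nn_integral_cong refl arg_cong2[where f = "(*)"] coord_avg_upd_other) auto
    finally show ?thesis using 1 by (meson add_right_mono order_trans)
  qed
  have avg_meas: "(\<lambda>x. coord_avg M j f x * coord_avg M j g x) \<in> borel_measurable ?Q" if "j \<in> insert i I" for j
    using coord_avg_measurable[OF f that] coord_avg_measurable[OF g that] by auto
  have avg_meas': "(\<lambda>y. \<integral>\<^sup>+ x. coord_avg M j f (x(i := y)) * coord_avg M j g (x(i := y)) \<partial>?P) \<in> borel_measurable M"
    if "j \<in> insert i I" for j
    using P.borel_measurable_nn_integral[OF pair[OF avg_meas[OF that]]] by simp
  have fB: "(\<lambda>x. f x * B x) \<in> borel_measurable ?Q" by measurable
  have "(\<integral>\<^sup>+ x. f x \<partial>?Q) * T = (\<integral>\<^sup>+ y. p y * T \<partial>M)"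
    using insert.hyps by (subst nn_integral_insert_rev) (auto simp: nn_integral_multc p_def[symmetric])
  also have "\<dots> \<le> (\<integral>\<^sup>+ y. (\<Sum>j\<in>I. \<integral>\<^sup>+ x. coord_avg M j f (x(i := y)) * coord_avg M j g (x(i := y)) \<partial>?P)
      + (\<integral>\<^sup>+ x. f (x(i := y)) * B (x(i := y)) \<partial>?P) \<partial>M)"
    by (intro nn_integral_mono key)
  also have "\<dots> = (\<Sum>j\<in>I. \<integral>\<^sup>+ y. \<integral>\<^sup>+ x. coord_avg M j f (x(i := y)) * coord_avg M j g (x(i := y)) \<partial>?P \<partial>M)
      + (\<integral>\<^sup>+ y. \<integral>\<^sup>+ x. f (x(i := y)) * B (x(i := y)) \<partial>?P \<partial>M)"
    using avg_meas' P.borel_measurable_nn_integral[OF pair[OF fB]]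
    by (subst nn_integral_add) (auto simp: nn_integral_sum)
  also have "(\<integral>\<^sup>+ y. \<integral>\<^sup>+ x. f (x(i := y)) * B (x(i := y)) \<partial>?P \<partial>M) = (\<integral>\<^sup>+ x. f x * B x \<partial>?Q)"
    using insert.hyps fB by (intro nn_integral_insert_rev[symmetric]) auto
  \<comment> \<open>\<open>B\<close> is constant in coordinate \<open>i\<close>, so \<open>f\<close>
    may be replaced by its average in that direction.\<close>
  also have "\<dots> = (\<integral>\<^sup>+ x. coord_avg M i f x * coord_avg M i g x \<partial>?Q)"
    using insert.hyps unfolding B_def
    by (intro nn_integral_mult_coord_avg[symmetric]) (auto simp: coord_avg_upd_same)
  also have "(\<Sum>j\<in>I. \<integral>\<^sup>+ y. \<integral>\<^sup>+ x. coord_avg M j f (x(i := y)) * coord_avg M j g (x(i := y)) \<partial>?P \<partial>M) =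
      (\<Sum>j\<in>I. \<integral>\<^sup>+ x. coord_avg M j f x * coord_avg M j g x \<partial>?Q)"
    using insert.hyps avg_meas by (intro sum.cong nn_integral_insert_rev[symmetric]) auto
  finally show ?case using insert.hyps by (simp add: T_def add.commute)
qed

end

section \<open>The one-dimensional measure\<close>

lemma enlargement_eq_Union_ball: "enlargement A h = (\<Union>y\<in>A. ball y h)"
proof (intro set_eqI iffI)
  fix x assume "x \<in> enlargement A h"
  then have "A \<noteq> {}" "infdist x A < h" by (simp_all add: enlargement_def)
  then have "A \<noteq> {}" "(INF a\<in>A. dist x a) < h" by (simp_all add: infdist_notempty)
  then obtain y where "y \<in> A" "dist x y < h"
    by (subst (asm) cINF_less_iff) auto
  then show "x \<in> (\<Union>y\<in>A. ball y h)" by (auto simp: dist_commute)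
next
  fix x assume "x \<in> (\<Union>y\<in>A. ball y h)"
  then obtain y where "y \<in> A" "dist x y < h" by (auto simp: dist_commute)
  then show "x \<in> enlargement A h"
    using infdist_le[of y A x] by (auto simp: enlargement_def)
qed

text \<open>A union of open balls is open, whatever the set \<open>A\<close> is.\<close>

lemma enlargement_borel [measurable]: "enlargement A h \<in> sets borel"
  by (simp add: enlargement_eq_Union_ball open_UN borel_open)

lemma subset_enlargement: "0 < h \<Longrightarrow> A \<subseteq> enlargement A h"
  by (force simp: enlargement_eq_Union_ball)

text \<open>Let \<open>a\<close> be the supremum of the points of \<open>B\<close> up to
  \<open>z\<close>. Points of \<open>B\<close> lie arbitrarily close to the left of \<open>a\<close>
  and none in \<open>(a, z]\<close>; since \<open>z\<close> is outside the enlargement, the points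
  of \<open>B\<close> up to \<open>z\<close> keep distance \<open>h\<close> from it, which leaves
  room for an interval of length \<open>h\<close>.\<close>

lemma gap_right_of_set:
  fixes B :: "real set"
  assumes "p \<in> B" "p < z" "z \<notin> enlargement B h" "0 < h"
  shows "\<exists>a. p \<le> a \<and> a + h \<le> z \<and> {a<..<a + h} \<subseteq> enlargement B h - B"
proof -
  define S where "S = B \<inter> {..z}"
  define a where "a = Sup S"
  have S: "S \<noteq> {}" "bdd_above S" using assms by (auto simp: S_def)
  have far: "b \<le> z - h" if "b \<in> S" for b
    using that assms(3) by (force simp: S_def enlargement_eq_Union_ball dist_real_def not_less)
  have "p \<le> a" unfolding a_def using S assms by (intro cSup_upper) (auto simp: S_def)
  moreover have "a \<le> z - h" unfolding a_def using S far by (intro cSup_least) auto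
  moreover have "y \<in> enlargement B h - B" if y: "y \<in> {a<..<a + h}" for y
  proof
    have "y - h < Sup S" using y by (simp add: a_def)
    then obtain b where b: "b \<in> S" "y - h < b" using S by (subst (asm) less_cSup_iff) auto
    have "b \<le> a" unfolding a_def using S b by (intro cSup_upper)
    then show "y \<in> enlargement B h"
      using b y by (force simp: S_def enlargement_eq_Union_ball dist_real_def)
    show "y \<notin> B"
    proof
      assume "y \<in> B"
      then have "y \<in> S" using y \<open>a \<le> z - h\<close> by (auto simp: S_def)
      then have "y \<le> a" unfolding a_def using S by (intro cSup_upper)
      then show False using y by simp
    qed
  qed
  ultimately show ?thesis by (intro exI[of _ a]) auto
qed

text \<open>Reflection at 0 reduces this to \<open>gap_right_of_set\<close>.\<close>

lemma gap_left_of_set: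
  fixes B :: "real set"
  assumes "p \<in> B" "z < p" "z \<notin> enlargement B h" "0 < h"
  shows "\<exists>a. z \<le> a \<and> a + h \<le> p \<and> {a<..<a + h} \<subseteq> enlargement B h - B"
proof -
  have e: "y \<in> enlargement (uminus ` B) h \<longleftrightarrow> - y \<in> enlargement B h" for y
    by (auto simp: enlargement_eq_Union_ball dist_real_def abs_minus_commute)
      (metis abs_minus_commute add.commute diff_minus_eq_add uminus_add_conv_diff)+
  from gap_right_of_set[of "- p" "uminus ` B" "- z" h] assms obtain a where
    a: "- p \<le> a" "a + h \<le> - z" "{a<..<a + h} \<subseteq> enlargement (uminus ` B) h - uminus ` B"
    by (auto simp: e)
  have "y \<in> enlargement B h - B" if "y \<in> {- a - h<..<- a}" for y
  proof -
    have "- y \<in> enlargement (uminus ` B) h - uminus ` B" using that a(3) by (intro subsetD[OF a(3)]) auto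
    then show ?thesis by (auto simp: e)
  qed
  then show ?thesis using a(1,2) by (intro exI[of _ "- a - h"]) auto
qed

locale convex_potential =
  fixes \<Psi> :: "real \<Rightarrow> real"
  assumes nonneg: "\<And>x. x \<ge> 0 \<Longrightarrow> \<Psi> x \<ge> 0"
    and convex: "convex_on {0..} \<Psi>"
    and sqrt_concave: "concave_on {0..} (\<lambda>x. sqrt (\<Psi> x))"
    and zero: "\<Psi> 0 = 0"
    and prob: "prob_space (mu \<Psi>)"
begin

sublocale prob_space "mu \<Psi>" by (rule prob)

lemma sets_mu [simp, measurable_cong]: "sets (mu \<Psi>) = sets borel"
  by (simp add: mu_def)

lemma space_mu [simp]: "space (mu \<Psi>) = UNIV"
  by (simp add: mu_def)

section \<open>Growth of the potential\<close>

lemma Psi_scale_lower: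
  assumes "0 \<le> x" "1 \<le> l"
  shows "l * \<Psi> x \<le> \<Psi> (l * x)"
proof -
  have "\<Psi> ((1 - 1 / l) * 0 + (1 / l) * (l * x)) \<le> (1 - 1 / l) * \<Psi> 0 + (1 / l) * \<Psi> (l * x)"
    using assms convex_onD[OF convex, of "1 / l" 0 "l * x"] by simp
  then show ?thesis using assms by (simp add: zero field_simps)
qed

text \<open>Concavity of the square root on the segment from 0 to \<open>l * x\<close>, just as
  convexity on this segment gives the lower bound. The potential thus grows at least linearly and at
  most quadratically under scaling.\<close>

lemma Psi_scale_upper:
  assumes "0 \<le> x" "1 \<le> l"
  shows "\<Psi> (l * x) \<le> l\<^sup>2 * \<Psi> x"
proof -
  have "sqrt (\<Psi> ((1 - 1 / l) * 0 + (1 / l) * (l * x))) \<ge> (1 - 1 / l) * sqrt (\<Psi> 0) + (1 / l) * sqrt (\<Psi> (l * x))"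
    using assms concave_onD[OF sqrt_concave, of "1 / l" 0 "l * x"] by simp
  then have "sqrt (\<Psi> (l * x)) \<le> l * sqrt (\<Psi> x)" using assms by (simp add: zero field_simps)
  then have "(sqrt (\<Psi> (l * x)))\<^sup>2 \<le> (l * sqrt (\<Psi> x))\<^sup>2"
    using assms nonneg by (intro power_mono) auto
  then show ?thesis using assms nonneg by (simp add: power_mult_distrib)
qed

lemma Psi_mono:
  assumes "0 \<le> x" "x \<le> y"
  shows "\<Psi> x \<le> \<Psi> y"
proof (cases "x = 0")
  case True then show ?thesis using nonneg[of y] assms by (simp add: zero)
next
  case False
  have "1 * \<Psi> x \<le> (y / x) * \<Psi> x" using False assms nonneg[of x] by (intro mult_right_mono) auto
  also have "\<dots> \<le> \<Psi> ((y / x) * x)" using False assms by (intro Psi_scale_lower) auto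
  finally show ?thesis using False by simp
qed

text \<open>Both \<open>x + u\<close> and \<open>y\<close> are convex combinations of
  \<open>x\<close> and \<open>y + u\<close>, and their weights at \<open>y + u\<close> add up to 1.
  The claim is the sum of the two convexity inequalities.\<close>

lemma Psi_increment_mono:
  assumes "0 \<le> x" "x \<le> y" "0 \<le> u"
  shows "\<Psi> (x + u) + \<Psi> y \<le> \<Psi> (y + u) + \<Psi> x"
proof (cases "y + u - x = 0")
  case True
  then have "u = 0" "x = y" using assms by auto
  then show ?thesis by simp
next
  case False
  define L where "L = y + u - x"
  have L: "0 < L" using False assms by (simp add: L_def)
  have conv: "(1 - t) * x + t * (y + u) = x + t * L" for t by (simp add: L_def algebra_simps)
  have e1: "(1 - u / L) * x + u / L * (y + u) = x + u"
    and e2: "(1 - (y - x) / L) * x + (y - x) / L * (y + u) = y"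
    unfolding conv using L by auto
  have s: "u / L + (y - x) / L = 1"
    using L by (simp add: L_def algebra_simps flip: add_divide_distrib diff_divide_distrib)
  have r: "0 \<le> u / L" "u / L \<le> 1" "0 \<le> (y - x) / L" "(y - x) / L \<le> 1"
    using L assms by (auto simp: L_def)
  have "\<Psi> (x + u) \<le> (1 - u / L) * \<Psi> x + u / L * \<Psi> (y + u)"
    by (rule convex_onD[OF convex, of "u / L" x "y + u", unfolded real_scaleR_def e1]) (use r assms in auto)
  moreover have "\<Psi> y \<le> (1 - (y - x) / L) * \<Psi> x + (y - x) / L * \<Psi> (y + u)"
    by (rule convex_onD[OF convex, of "(y - x) / L" x "y + u", unfolded real_scaleR_def e2]) (use r assms in auto)
  ultimately have "\<Psi> (x + u) + \<Psi> y \<le> (2 - (u / L + (y - x) / L)) * \<Psi> x + (u / L + (y - x) / L) * \<Psi> (y + u)"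
    by (simp add: algebra_simps)
  then show ?thesis unfolding s by simp
qed

section \<open>Density, tail and hazard rate\<close>

definition dens :: "real \<Rightarrow> real" where "dens x = exp (- \<Psi> \<bar>x\<bar>) / norm_const \<Psi>"

definition tail :: "real \<Rightarrow> real" where "tail x = measure (mu \<Psi>) {x..}"

definition hazard :: "real \<Rightarrow> real" where "hazard x = dens x / tail x"

lemma mu_eq_density: "mu \<Psi> = density lborel (\<lambda>x. ennreal (dens x))"
  by (simp add: mu_def dens_def)

text \<open>A divergent integral has the default value 0, and so has division by 0. A vanishing
  constant would therefore make \<open>mu \<Psi>\<close> the null measure, which the assumption
  \<open>prob\<close> excludes; integrability follows from this.\<close>

lemma norm_const_nonzero: "norm_const \<Psi> \<noteq> 0"
proof
  assume "norm_const \<Psi> = 0"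
  then have "emeasure (mu \<Psi>) UNIV = 0" by (simp add: mu_eq_density dens_def emeasure_density)
  then show False using emeasure_space_1 by simp
qed

lemma norm_const_pos: "0 < norm_const \<Psi>"
proof -
  have "0 \<le> norm_const \<Psi>" unfolding norm_const_def by (intro integral_nonneg_AE) auto
  then show ?thesis using norm_const_nonzero by simp
qed

lemma integrable_exp_Psi: "integrable lborel (\<lambda>x. exp (- \<Psi> \<bar>x\<bar>))"
  using norm_const_nonzero unfolding norm_const_def by (metis not_integrable_integral_eq)

lemma dens_measurable [measurable]: "dens \<in> borel_measurable borel"
  using borel_measurable_integrable[OF integrable_exp_Psi] unfolding dens_def[abs_def] by simp

lemma dens_pos: "0 < dens x" using norm_const_pos by (simp add: dens_def)

lemma dens_nonneg [simp]: "0 \<le> dens x" using dens_pos[of x] by simp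

lemma dens_minus [simp]: "dens (- x) = dens x" by (simp add: dens_def)

lemma dens_antimono: "\<bar>x\<bar> \<le> \<bar>y\<bar> \<Longrightarrow> dens y \<le> dens x"
  using Psi_mono[of "\<bar>x\<bar>" "\<bar>y\<bar>"] norm_const_pos by (simp add: dens_def divide_right_mono)

lemma emeasure_mu: "A \<in> sets borel \<Longrightarrow> emeasure (mu \<Psi>) A = (\<integral>\<^sup>+ x. ennreal (dens x) * indicator A x \<partial>lborel)"
  by (simp add: mu_eq_density emeasure_density)

lemma measure_lower:
  assumes [measurable]: "S \<in> sets borel" and "\<And>x. x \<in> S \<Longrightarrow> c \<le> dens x"
    and "emeasure lborel S = ennreal l" "0 \<le> c" "0 \<le> l"
  shows "c * l \<le> measure (mu \<Psi>) S"
proof -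
  have "ennreal (c * l) = (\<integral>\<^sup>+ x. ennreal c * indicator S x \<partial>lborel)"
    using assms by (simp add: nn_integral_cmult ennreal_mult)
  also have "\<dots> \<le> emeasure (mu \<Psi>) S"
    unfolding emeasure_mu[OF assms(1)] using assms
    by (intro nn_integral_mono) (auto simp: indicator_def intro!: ennreal_leI)
  finally show ?thesis by (simp add: emeasure_eq_measure)
qed

lemma measure_upper:
  assumes [measurable]: "S \<in> sets borel" and "\<And>x. x \<in> S \<Longrightarrow> dens x \<le> c"
    and "emeasure lborel S = ennreal l" "0 \<le> c" "0 \<le> l"
  shows "measure (mu \<Psi>) S \<le> c * l"
proof -
  have "emeasure (mu \<Psi>) S \<le> (\<integral>\<^sup>+ x. ennreal c * indicator S x \<partial>lborel)"
    unfolding emeasure_mu[OF assms(1)] using assms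
    by (intro nn_integral_mono) (auto simp: indicator_def intro!: ennreal_leI)
  also have "\<dots> = ennreal (c * l)"
    using assms by (simp add: nn_integral_cmult ennreal_mult)
  finally show ?thesis using assms by (simp add: emeasure_eq_measure)
qed

lemma measure_singleton: "measure (mu \<Psi>) {x} = 0"
  using measure_upper[of "{x}" "dens x" 0] by (simp add: measure_le_0_iff)

lemma measure_atMost_minus: "measure (mu \<Psi>) {..- x} = tail x"
proof -
  have "emeasure (mu \<Psi>) {..- x} = (\<integral>\<^sup>+ t. ennreal (dens (- t)) * indicator {..- x} (- t) \<partial>lborel)"
    unfolding emeasure_mu[OF borel_closed[OF closed_atMost]]
    by (subst nn_integral_real_affine[of _ "-1" 0]) auto
  also have "\<dots> = emeasure (mu \<Psi>) {x..}"
    by (subst emeasure_mu) (auto intro!: nn_integral_cong simp: indicator_def)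
  finally show ?thesis by (simp add: tail_def measure_def)
qed

lemma measure_lessThan_minus: "measure (mu \<Psi>) {..<- x} = tail x"
proof -
  have "measure (mu \<Psi>) ({..<- x} \<union> {- x}) = measure (mu \<Psi>) {..<- x} + measure (mu \<Psi>) {- x}"
    by (intro finite_measure_Union) auto
  also have "{..<- x} \<union> {- x} = {..- x}" by auto
  finally show ?thesis by (simp add: measure_atMost_minus measure_singleton)
qed

lemma tail_diff: "x \<le> y \<Longrightarrow> tail x = tail y + measure (mu \<Psi>) {x..<y}"
proof -
  assume "x \<le> y"
  then have "{x..} = {y..} \<union> {x..<y}" by auto
  then have "measure (mu \<Psi>) {x..} = measure (mu \<Psi>) ({y..} \<union> {x..<y})" by simp
  also have "\<dots> = tail y + measure (mu \<Psi>) {x..<y}"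
    unfolding tail_def by (intro finite_measure_Union) auto
  finally show ?thesis by (simp add: tail_def)
qed

lemma tail_antimono: "x \<le> y \<Longrightarrow> tail y \<le> tail x"
  using tail_diff[of x y] by simp

lemma tail_strict_antimono: "x < y \<Longrightarrow> tail y < tail x"
proof -
  assume xy: "x < y"
  define c where "c = dens (max \<bar>x\<bar> \<bar>y\<bar>)"
  have "c * (y - x) \<le> measure (mu \<Psi>) {x..<y}"
    using xy by (intro measure_lower) (auto simp: c_def intro!: dens_antimono)
  moreover have "0 < c * (y - x)" using xy dens_pos by (simp add: c_def)
  ultimately show ?thesis using tail_diff[of x y] xy by linarith
qed

lemma tail_less_iff: "tail x < tail y \<longleftrightarrow> y < x"
  using tail_strict_antimono[of y x] tail_antimono[of x y] by linarith

lemma tail_le_iff: "tail x \<le> tail y \<longleftrightarrow> y \<le> x"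
  using tail_less_iff[of y x] by linarith

lemma tail_nonneg [simp]: "0 \<le> tail x" by (simp add: tail_def)

lemma tail_pos: "0 < tail x"
  using tail_strict_antimono[of x "x + 1"] tail_nonneg[of "x + 1"] by linarith

lemma tail_lipschitz: "x \<le> y \<Longrightarrow> tail x - tail y \<le> dens 0 * (y - x)"
  using tail_diff[of x y] measure_upper[of "{x..<y}" "dens 0" "y - x"] by (simp add: dens_antimono)

lemma continuous_on_tail: "continuous_on S tail"
proof -
  have "(dens 0)-lipschitz_on S tail"
  proof (rule lipschitz_onI)
    fix x y show "dist (tail x) (tail y) \<le> dens 0 * dist x y"
      using tail_lipschitz[of x y] tail_lipschitz[of y x] tail_antimono[of x y] tail_antimono[of y x]
      by (cases "x \<le> y") (auto simp: dist_real_def)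
  qed simp
  then show ?thesis by (rule lipschitz_on_continuous_on)
qed

lemma tail_zero: "tail 0 = 1 / 2"
proof -
  have "measure (mu \<Psi>) ({..<0} \<union> {0..}) = measure (mu \<Psi>) {..<0} + measure (mu \<Psi>) {0..}"
    by (intro finite_measure_Union) auto
  also have "{..<0} \<union> {0..} = (UNIV :: real set)" by auto
  finally show ?thesis using measure_lessThan_minus[of 0] prob_space by (simp add: tail_def)
qed

lemma tail_tendsto_0: "(\<lambda>n. tail (real n)) \<longlonglongrightarrow> 0"
proof -
  have "(\<lambda>n. measure (mu \<Psi>) {real n..}) \<longlonglongrightarrow> measure (mu \<Psi>) (\<Inter>n. {real n..})"
    by (intro finite_Lim_measure_decseq) (auto simp: decseq_def)
  moreover have "(\<Inter>n. {real n..}) = {}"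
    by (auto simp: not_le) (meson not_le reals_Archimedean2)
  ultimately show ?thesis by (simp add: tail_def)
qed

text \<open>Lets every level in \<open>(0, 1/2]\<close> be written as the tail at a nonnegative
  point, so that profiles are parametrized by points instead of by an inverse of
  \<open>H\<close>.\<close>

lemma tail_surj:
  assumes "0 < b" "b \<le> 1 / 2"
  shows "\<exists>x\<ge>0. tail x = b"
proof -
  obtain n where "tail (real n) < b"
    using order_tendstoD(2)[OF tail_tendsto_0 assms(1)] by (auto dest: eventually_happens)
  then have "\<exists>x. 0 \<le> x \<and> x \<le> real n \<and> tail x = b"
    using assms tail_zero by (intro IVT2' continuous_on_tail) auto
  then show ?thesis by blast
qed

lemma tail_minus: "tail (- x) = 1 - tail x"
proof -
  have "measure (mu \<Psi>) ({..<- x} \<union> {- x..}) = measure (mu \<Psi>) {..<- x} + measure (mu \<Psi>) {- x..}"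
    by (intro finite_measure_Union) auto
  also have "{..<- x} \<union> {- x..} = (UNIV :: real set)" by auto
  finally show ?thesis using prob_space by (simp add: measure_lessThan_minus tail_def)
qed

lemma measure_symmetric_interval: "0 \<le> q \<Longrightarrow> measure (mu \<Psi>) {- q..q} = 1 - 2 * tail q"
proof -
  assume q: "0 \<le> q"
  note tail_minus[of q]
  moreover have "measure (mu \<Psi>) ({- q..<q} \<union> {q}) = measure (mu \<Psi>) {- q..<q} + measure (mu \<Psi>) {q}"
    by (intro finite_measure_Union) auto
  moreover have "{- q..<q} \<union> {q} = {- q..q}" using q by auto
  ultimately show ?thesis using tail_diff[of "- q" q] q by (simp add: measure_singleton)
qed

text \<open>Shifting all tails to the same domain of integration allows a pointwise comparison of
  the integrands.\<close>

lemma emeasure_tail: "emeasure (mu \<Psi>) {x..} = (\<integral>\<^sup>+ u. ennreal (dens (x + u)) * indicator {0..} u \<partial>lborel)"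
  unfolding emeasure_mu[OF borel_closed[OF closed_atLeast]]
  by (subst nn_integral_real_affine[of _ 1 x]) (auto intro!: nn_integral_cong simp: indicator_def)

section \<open>Estimates of the hazard rate\<close>

lemma hazard_pos: "0 < hazard x"
  by (simp add: hazard_def dens_pos tail_pos)

lemma dens_eq_hazard: "dens x = hazard x * tail x"
  using tail_pos[of x] by (simp add: hazard_def)

text \<open>Log-concavity of the density gives
  \<open>dens x * dens (y + u) \<le> dens y * dens (x + u)\<close> for \<open>u \<ge> 0\<close>;
  integration over \<open>u\<close> replaces the shifted densities by tails.\<close>

lemma hazard_mono:
  assumes "0 \<le> x" "x \<le> y"
  shows "hazard x \<le> hazard y"
proof -
  have "ennreal (dens x * tail y) = ennreal (dens x) * emeasure (mu \<Psi>) {y..}"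
    by (simp add: tail_def emeasure_eq_measure ennreal_mult)
  also have "\<dots> = (\<integral>\<^sup>+ u. ennreal (dens x) * (ennreal (dens (y + u)) * indicator {0..} u) \<partial>lborel)"
    unfolding emeasure_tail by (rule nn_integral_cmult[symmetric]) auto
  also have "\<dots> \<le> (\<integral>\<^sup>+ u. ennreal (dens y) * (ennreal (dens (x + u)) * indicator {0..} u) \<partial>lborel)"
  proof (intro nn_integral_mono)
    fix u :: real
    have "dens x * dens (y + u) \<le> dens y * dens (x + u)" if "0 \<le> u"
      using Psi_increment_mono[of x y u] that assms norm_const_pos
      by (simp add: dens_def divide_right_mono flip: exp_add)
    then show "ennreal (dens x) * (ennreal (dens (y + u)) * indicator {0..} u) \<le>
      ennreal (dens y) * (ennreal (dens (x + u)) * indicator {0..} u)"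
      by (auto simp: indicator_def ennreal_mult[symmetric] intro!: ennreal_leI)
  qed
  also have "\<dots> = ennreal (dens y) * emeasure (mu \<Psi>) {x..}"
    unfolding emeasure_tail by (rule nn_integral_cmult) auto
  also have "\<dots> = ennreal (dens y * tail x)"
    by (simp add: tail_def emeasure_eq_measure ennreal_mult)
  finally have "dens x * tail y \<le> dens y * tail x" by (simp add: ennreal_le_iff)
  then show ?thesis using tail_pos[of x] tail_pos[of y] by (simp add: hazard_def field_simps)
qed

text \<open>Beyond \<open>x\<close> the potential lies above the line through the origin of slope
  \<open>\<Psi> x / x\<close>, so the tail is dominated by that of an exponential distribution with
  this rate.\<close>

lemma hazard_lower:
  assumes x: "0 < x"
  shows "\<Psi> x / x \<le> hazard x"
proof (cases "\<Psi> x = 0")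
  case True then show ?thesis using hazard_pos[of x] by simp
next
  case False
  define c where "c = \<Psi> x / x"
  have c: "0 < c" using False nonneg[of x] x by (auto simp: c_def)
  have dec: "dens (x + u) \<le> dens x * exp (- u * c)" if "0 \<le> u" for u
  proof -
    have "(1 + u / x) * \<Psi> x \<le> \<Psi> ((1 + u / x) * x)" using x that by (intro Psi_scale_lower) auto
    also have "(1 + u / x) * x = x + u" using x by (simp add: field_simps)
    finally have "\<Psi> x + u * c \<le> \<Psi> (x + u)" by (simp add: c_def algebra_simps)
    then show ?thesis using x that norm_const_pos
      by (simp add: dens_def divide_right_mono flip: exp_add)
  qed
  have "ennreal (tail x) = (\<integral>\<^sup>+ u. ennreal (dens (x + u)) * indicator {0..} u \<partial>lborel)"
    unfolding emeasure_tail[symmetric] by (simp add: tail_def emeasure_eq_measure)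
  also have "\<dots> \<le> (\<integral>\<^sup>+ u. ennreal (dens x / c) * ennreal (exponential_density c u) \<partial>lborel)"
    using c dec
    by (intro nn_integral_mono) (auto simp: indicator_def exponential_density_def ennreal_mult[symmetric] intro!: ennreal_leI)
  also have "\<dots> = ennreal (dens x / c) * emeasure (density lborel (exponential_density c)) UNIV"
    by (simp add: nn_integral_cmult emeasure_density)
  also have "emeasure (density lborel (exponential_density c)) UNIV = 1"
    using prob_space.emeasure_space_1[OF prob_space_exponential_density[OF c]] by simp
  finally have "tail x \<le> dens x / c" using c by (simp add: ennreal_le_iff)
  then show ?thesis using c tail_pos[of x] by (simp add: hazard_def field_simps flip: c_def)
qed

text \<open>On an interval of length \<open>x / \<Psi> x\<close> to the right of \<open>x\<close>
  the potential grows by at most 3, by quadratic growth. The density loses at most the factor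
  \<open>exp 3\<close> there, and this interval alone bounds the tail from below.\<close>

lemma hazard_upper:
  assumes x: "0 < x" and P: "1 \<le> \<Psi> x"
  shows "hazard x \<le> exp 3 * \<Psi> x / x"
proof -
  define d where "d = x / \<Psi> x"
  have d: "0 < d" using x P by (simp add: d_def)
  have "\<Psi> ((1 + 1 / \<Psi> x) * x) \<le> (1 + 1 / \<Psi> x)\<^sup>2 * \<Psi> x"
    using x P by (intro Psi_scale_upper) auto
  also have "(1 + 1 / \<Psi> x) * x = x + d" by (simp add: d_def field_simps)
  also have "(1 + 1 / \<Psi> x)\<^sup>2 * \<Psi> x = \<Psi> x + 2 + 1 / \<Psi> x"
    using P by (simp add: power2_eq_square field_simps)
  also have "\<dots> \<le> \<Psi> x + 3" using P by simp
  finally have "dens x * exp (- 3) \<le> dens (x + d)"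
    using x d norm_const_pos by (simp add: dens_def divide_right_mono flip: exp_add)
  moreover have "dens (x + d) * d \<le> measure (mu \<Psi>) {x..<x + d}"
    using x d by (intro measure_lower) (auto intro!: dens_antimono)
  moreover have "measure (mu \<Psi>) {x..<x + d} \<le> tail x" using tail_diff[of x "x + d"] d by simp
  ultimately have "dens x * exp (- 3) * d \<le> tail x"
    using d by (meson mult_right_mono less_imp_le order_trans)
  then have "dens x \<le> exp 3 * tail x / d"
    using d by (simp add: exp_minus field_simps)
  also have "\<dots> = exp 3 * \<Psi> x / x * tail x" using x P by (simp add: d_def)
  finally show ?thesis using tail_pos[of x] by (simp add: hazard_def divide_le_eq)
qed

text \<open>The isoperimetric inequality on the line, stated for a definite range of
  \<open>h\<close> and not only in the limit: it is applied to all sections of a set with the same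
  \<open>h\<close>.\<close>

lemma measure_enlargement_ge:
  assumes [measurable]: "B \<in> sets borel" and x: "0 \<le> x" and h: "0 < h" "h * hazard x \<le> 2"
    and b: "b = min (measure (mu \<Psi>) B) (1 - measure (mu \<Psi>) B)" "b \<le> tail x"
  shows "measure (mu \<Psi>) B + h * hazard x / 4 * b \<le> measure (mu \<Psi>) (enlargement B h)"
proof (cases "b = 0")
  case True
  have "measure (mu \<Psi>) B \<le> measure (mu \<Psi>) (enlargement B h)"
    using subset_enlargement[OF h(1)] by (intro finite_measure_mono) auto
  then show ?thesis using True by simp
next
  case False
  let ?m = "measure (mu \<Psi>)"
  have "0 \<le> b" using b(1) prob_le_1[of B] by simp
  then have b0: "0 < b" using False by simp
  have bh: "b \<le> 1 / 2" "b \<le> ?m B" "b \<le> 1 - ?m B" using b(1) by linarith+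
  \<comment> \<open>With a quarter of \<open>b\<close> outside on each side, the interval
    \<open>[-q, q]\<close> misses mass \<open>b/2\<close> only: less than the mass of
    \<open>B\<close>, so that it meets \<open>B\<close>, and still exceeding the mass of
    \<open>B\<close> by at least \<open>b/2\<close>. Moreover \<open>q\<close> lies to the right of
    \<open>x\<close>, where the hazard rate is larger.\<close>
  obtain q where q: "0 \<le> q" "tail q = b / 4" using tail_surj[of "b / 4"] b0 bh by auto
  have "x \<le> q" using q(2) b(2) b0 tail_le_iff[of q x] by linarith
  then have hq: "hazard x \<le> hazard q" using x by (intro hazard_mono)
  have mI: "?m {- q..q} = 1 - b / 2" using measure_symmetric_interval[OF q(1)] q by simp
  have "?m ((B \<inter> {- q..q}) \<union> ({- q..q} - B)) = ?m (B \<inter> {- q..q}) + ?m ({- q..q} - B)"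
    by (intro finite_measure_Union) auto
  moreover have "(B \<inter> {- q..q}) \<union> ({- q..q} - B) = {- q..q}" by auto
  ultimately have "?m {- q..q} = ?m (B \<inter> {- q..q}) + ?m ({- q..q} - B)" by simp
  moreover have "?m (B \<union> ({- q..q} - B)) = ?m B + ?m ({- q..q} - B)"
    by (intro finite_measure_Union) auto
  ultimately have "0 < ?m (B \<inter> {- q..q})"
    using mI bh b0 prob_le_1[of "B \<union> ({- q..q} - B)"] by linarith
  then obtain p where p: "p \<in> B" "p \<in> {- q..q}" by (metis Int_iff ex_in_conv less_irrefl measure_empty)
  show ?thesis
  proof (cases "{- q..q} \<subseteq> enlargement B h")
    case True
    then have "?m {- q..q} \<le> ?m (enlargement B h)" by (intro finite_measure_mono) auto
    \<comment> \<open>The restriction on \<open>h\<close> keeps the claimed gain below the surplus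
      \<open>b/2\<close>.\<close>
    moreover have "h * hazard x / 4 * b \<le> b / 2" using mult_right_mono[OF h(2), of b] b0 by simp
    ultimately show ?thesis using mI bh by linarith
  next
    case False
    then obtain z where z: "z \<in> {- q..q}" "z \<notin> enlargement B h" by blast
    have "p \<noteq> z" using p z subset_enlargement[OF h(1), of B] by auto
    have "\<exists>a. - q \<le> a \<and> a + h \<le> q \<and> {a<..<a + h} \<subseteq> enlargement B h - B"
    proof (cases "p < z")
      case True
      from gap_right_of_set[OF p(1) True z(2) h(1)] p(2) z(1) show ?thesis
        by (meson atLeastAtMost_iff order_trans)
    next
      case False
      then have "z < p" using \<open>p \<noteq> z\<close> by simp
      from gap_left_of_set[OF p(1) this z(2) h(1)] p(2) z(1) show ?thesis
        by (meson atLeastAtMost_iff order_trans)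
    qed
    then obtain a where a: "- q \<le> a" "a + h \<le> q" "{a<..<a + h} \<subseteq> enlargement B h - B"
      by blast
    have "dens q * h \<le> ?m {a<..<a + h}"
      using a h by (intro measure_lower) (auto intro!: dens_antimono)
    moreover have "?m B + ?m {a<..<a + h} = ?m (B \<union> {a<..<a + h})"
      using a(3) by (intro finite_measure_Union[symmetric]) auto
    moreover have "?m (B \<union> {a<..<a + h}) \<le> ?m (enlargement B h)"
      using a(3) subset_enlargement[OF h(1), of B] by (intro finite_measure_mono) auto
    \<comment> \<open>Here \<open>dens q = hazard q * (b / 4)\<close>, which explains the factor 4
      in the claim.\<close>
    moreover have "h * hazard x / 4 * b \<le> dens q * h"
      using mult_right_mono[OF hq, of "h * b / 4"] h b0 q dens_eq_hazard[of q] by simp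
    ultimately show ?thesis by linarith
  qed
qed

text \<open>A potential without positive values would give a divergent normalizing integral. Any
  positive value can be scaled up to 1 by at least linear growth.\<close>

lemma Psi_unbounded: "\<exists>x>0. 1 \<le> \<Psi> x"
proof -
  have "\<exists>x>0. 0 < \<Psi> x"
  proof (rule ccontr)
    assume "\<not> (\<exists>x>0. 0 < \<Psi> x)"
    then have "\<Psi> x \<le> 0" if "0 < x" for x using that by force
    then have "\<Psi> \<bar>x\<bar> = 0" for x
      using nonneg[of "\<bar>x\<bar>"] zero by (cases "x = 0") (auto intro: antisym)
    then have "norm_const \<Psi> = 0" by (simp add: norm_const_def measure_def)
    then show False using norm_const_nonzero by simp
  qed
  then obtain x where x: "0 < x" "0 < \<Psi> x" by blast
  define l where "l = max 1 (1 / \<Psi> x)"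
  have l: "1 \<le> l" "1 / \<Psi> x \<le> l" by (auto simp: l_def)
  have "1 \<le> l * \<Psi> x" using l x by (simp add: field_simps)
  also have "\<dots> \<le> \<Psi> (l * x)" using l x by (intro Psi_scale_lower) auto
  finally show ?thesis using l x by (intro exI[of _ "l * x"]) auto
qed

text \<open>The tail at a bounded multiple of \<open>x\<close> is already smaller than \<open>\<kappa> * tail x ^ n\<close>, and the
  hazard rate varies only by a bounded factor between \<open>x\<close> and that multiple.\<close>

lemma hazard_comparison:
  assumes k: "0 < \<kappa>" and x0: "0 < x0" "1 \<le> \<Psi> x0"
  shows "\<exists>C>0. \<forall>x\<ge>x0. \<forall>y\<ge>0. \<kappa> * tail x ^ n \<le> tail y \<longrightarrow> hazard y \<le> C * hazard x"
proof -
  let ?Z = "norm_const \<Psi>"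
  \<comment> \<open>For \<open>y\<close> beyond \<open>l * x\<close>, the bounds
    \<open>tail y \<le> exp (- l * \<Psi> x) / (?Z * hazard 0)\<close> and
    \<open>tail x \<ge> x0 / ?Z * exp (- 4 * \<Psi> x)\<close> turn the hypothesis into
    \<open>exp ((l - 4 * n) * \<Psi> x) \<le> Q\<close>. The choice \<open>l - 4 * n = Q + 1\<close>
    contradicts this because \<open>\<Psi> x \<ge> 1\<close>.\<close>
  define Q where "Q = 1 / (?Z * hazard 0 * (\<kappa> * (x0 / ?Z) ^ n))"
  have Q: "0 < Q" using norm_const_pos hazard_pos[of 0] k x0 by (simp add: Q_def)
  define l where "l = 4 * real n + Q + 1"
  have l: "1 \<le> l" using Q by (simp add: l_def)
  have "hazard y \<le> (exp 3 * l) * hazard x"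
    if x: "x0 \<le> x" and y: "0 \<le> y" and le: "\<kappa> * tail x ^ n \<le> tail y" for x y
  proof (cases "y \<le> x")
    case True
    have "hazard y \<le> 1 * hazard x" using hazard_mono y True by simp
    also have "\<dots> \<le> (exp 3 * l) * hazard x"
      using hazard_pos[of x] l mult_mono[of 1 "exp 3" 1 l] by (intro mult_right_mono) auto
    finally show ?thesis .
  next
    case False
    have xpos: "0 < x" using x x0 by simp
    have Px: "1 \<le> \<Psi> x" using Psi_mono[of x0 x] x x0 by simp
    have Py: "1 \<le> \<Psi> y" using Psi_mono[of x y] False xpos Px by simp
    have "y \<le> l * x"
    proof (rule ccontr)
      assume "\<not> y \<le> l * x"
      then have yl: "l * x \<le> y" by simp
      have lx: "0 \<le> l * x" using l xpos by simp
      have "tail y \<le> tail (l * x)" using yl by (rule tail_antimono)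
      also have "\<dots> = dens (l * x) / hazard (l * x)"
        using hazard_pos[of "l * x"] by (simp add: dens_eq_hazard)
      also have "\<dots> \<le> dens (l * x) / hazard 0"
        using hazard_mono[of 0 "l * x"] lx hazard_pos by (intro divide_left_mono) auto
      also have "\<dots> \<le> (exp (- (l * \<Psi> x)) / ?Z) / hazard 0"
        using Psi_scale_lower[of x l] l lx xpos norm_const_pos hazard_pos[of 0]
        by (intro divide_right_mono) (auto simp: dens_def intro!: divide_right_mono)
      finally have 1: "tail y \<le> exp (- (l * \<Psi> x)) / ?Z / hazard 0" .
      \<comment> \<open>The mass of \<open>[x, 2x)\<close> suffices; on it the potential is at most
        \<open>4 * \<Psi> x\<close> by quadratic growth.\<close>
      have "x0 / ?Z * exp (- (4 * \<Psi> x)) \<le> tail x"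
      proof -
        have "x0 / ?Z * exp (- (4 * \<Psi> x)) \<le> x / ?Z * exp (- \<Psi> (2 * x))"
          using Psi_scale_upper[of x 2] xpos x x0 norm_const_pos
          by (intro mult_mono divide_right_mono) auto
        also have "\<dots> = dens (2 * x) * x" using xpos by (simp add: dens_def)
        also have "\<dots> \<le> measure (mu \<Psi>) {x..<2 * x}"
          using xpos by (intro measure_lower) (auto intro!: dens_antimono)
        also have "\<dots> \<le> tail x" using tail_diff[of x "2 * x"] xpos by simp
        finally show ?thesis .
      qed
      then have "\<kappa> * (x0 / ?Z * exp (- (4 * \<Psi> x))) ^ n \<le> \<kappa> * tail x ^ n"
        using k x0 norm_const_pos by (intro mult_left_mono power_mono) auto
      moreover have "(x0 / ?Z * exp (- (4 * \<Psi> x))) ^ n = (x0 / ?Z) ^ n * exp (- (4 * real n * \<Psi> x))"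
        unfolding power_mult_distrib exp_of_nat_mult[symmetric] by (simp add: ac_simps)
      ultimately have "\<kappa> * (x0 / ?Z) ^ n * exp (- (4 * real n * \<Psi> x)) \<le> exp (- (l * \<Psi> x)) / ?Z / hazard 0"
        using 1 le by (simp only: mult.assoc)
      then have "exp (- (4 * real n * \<Psi> x)) \<le> Q * exp (- (l * \<Psi> x))"
        using norm_const_pos hazard_pos[of 0] k x0 by (simp add: Q_def field_simps)
      then have "exp (- (4 * real n * \<Psi> x)) * exp (l * \<Psi> x) \<le> Q"
        by (simp add: exp_minus field_simps)
      then have "exp ((Q + 1) * \<Psi> x) \<le> Q"
        by (simp add: l_def algebra_simps flip: exp_add)
      moreover have "Q + 1 \<le> (Q + 1) * \<Psi> x" using Q Px by simp
      moreover have "(Q + 1) * \<Psi> x < exp ((Q + 1) * \<Psi> x)"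
        using exp_ge_add_one_self[of "(Q + 1) * \<Psi> x"] by linarith
      ultimately show False by linarith
    qed
    \<comment> \<open>The hazard rate is comparable to \<open>\<Psi> y / y\<close>, which by
      quadratic growth exceeds \<open>\<Psi> x / x\<close> at most by the factor
      \<open>y / x \<le> l\<close>.\<close>
    have "hazard y \<le> exp 3 * \<Psi> y / y" using False xpos Py by (intro hazard_upper) auto
    also have "\<dots> \<le> exp 3 * (l * (\<Psi> x / x))"
    proof -
      have "\<Psi> ((y / x) * x) \<le> (y / x)\<^sup>2 * \<Psi> x"
        using False xpos by (intro Psi_scale_upper) auto
      then have "\<Psi> y / y \<le> (y / x) * (\<Psi> x / x)"
        using False xpos by (simp add: power2_eq_square field_simps)
      also have "\<dots> \<le> l * (\<Psi> x / x)"
        using \<open>y \<le> l * x\<close> xpos Px by (intro mult_right_mono) (auto simp: field_simps)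
      finally show ?thesis using mult_left_mono[of "\<Psi> y / y" "l * (\<Psi> x / x)" "exp 3"] by simp
    qed
    also have "\<dots> \<le> exp 3 * (l * hazard x)"
      using hazard_lower[OF xpos] l by (intro mult_left_mono) auto
    finally show ?thesis by simp
  qed
  then show ?thesis using l by (intro exI[of _ "exp 3 * l"]) auto
qed

lemma continuous_dens: "isCont dens x" if "x > 0"
proof -
  have "continuous_on {0<..} \<Psi>"
    using convex by (intro convex_on_continuous) (auto intro: convex_on_subset)
  then have c: "isCont \<Psi> x" using that by (simp add: continuous_on_eq_continuous_at)
  have 1: "isCont (\<lambda>y. exp (- \<Psi> y) / norm_const \<Psi>) x"
    using c norm_const_nonzero by (intro continuous_intros) auto
  have 2: "\<forall>\<^sub>F y in nhds x. dens y = exp (- \<Psi> y) / norm_const \<Psi>"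
  proof -
    have "\<forall>\<^sub>F y in nhds x. y \<in> {0<..}" using that by (intro eventually_nhds_in_open) auto
    then show ?thesis by eventually_elim (simp add: dens_def)
  qed
  show ?thesis using isCont_cong[OF 2] 1 by simp
qed

text \<open>The half-line \<open>[q, \<infinity>)\<close> is the test set. Its enlargement adds at
  most \<open>[q - h, q)\<close>, where the density is at most its value at
  \<open>max 0 (q - h)\<close>; the maximum is needed once this interval reaches past the peak at 0.
  For \<open>q = 0\<close> the bound is constant, so continuity of the density is used at positive
  points only.\<close>

lemma isoperimetric_profile_le:
  assumes q: "0 \<le> q"
  shows "isoperimetric_profile (mu \<Psi>) (ennreal (tail q)) \<le> ennreal (dens q)"
proof -
  have "isoperimetric_profile (mu \<Psi>) (ennreal (tail q)) \<le> boundary_measure (mu \<Psi>) {q..}"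
    unfolding isoperimetric_profile_def by (intro INF_lower) (auto simp: emeasure_eq_measure tail_def)
  also have "\<dots> \<le> Liminf (at_right 0) (\<lambda>h. ennreal (dens (max 0 (q - h))))"
    unfolding boundary_measure_def
  proof (intro Liminf_mono)
    have "(emeasure (mu \<Psi>) (enlargement {q..} h) - emeasure (mu \<Psi>) {q..}) / ennreal h
        \<le> ennreal (dens (max 0 (q - h)))" if h: "0 < h" for h
    proof -
      have "enlargement {q..} h \<subseteq> {q - h..}"
        by (auto simp: enlargement_eq_Union_ball dist_real_def)
      then have "emeasure (mu \<Psi>) (enlargement {q..} h) \<le> emeasure (mu \<Psi>) {q - h..}"
        by (intro emeasure_mono) auto
      also have "\<dots> = ennreal (tail q + measure (mu \<Psi>) {q - h..<q})"
        using tail_diff[of "q - h" q] h by (simp add: emeasure_eq_measure tail_def)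
      finally have "emeasure (mu \<Psi>) (enlargement {q..} h) - emeasure (mu \<Psi>) {q..} \<le>
          ennreal (tail q + measure (mu \<Psi>) {q - h..<q}) - ennreal (tail q)"
        unfolding emeasure_eq_measure[of "{q..}"] tail_def[symmetric] by (rule ennreal_minus_mono) simp
      also have "\<dots> = ennreal (measure (mu \<Psi>) {q - h..<q})"
        by (simp add: ennreal_minus)
      also have "\<dots> \<le> ennreal (dens (max 0 (q - h)) * h)"
        using h by (intro ennreal_leI measure_upper) (auto intro!: dens_antimono)
      finally have "(emeasure (mu \<Psi>) (enlargement {q..} h) - emeasure (mu \<Psi>) {q..}) / ennreal h
        \<le> ennreal (dens (max 0 (q - h)) * h) / ennreal h"
        by (rule divide_right_mono_ennreal)
      then show ?thesis using h by (simp add: divide_ennreal)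
    qed
    then show "\<forall>\<^sub>F h in at_right 0. (emeasure (mu \<Psi>) (enlargement {q..} h) - emeasure (mu \<Psi>) {q..}) / ennreal h
        \<le> ennreal (dens (max 0 (q - h)))"
      by (auto simp: eventually_at_right_less intro: eventually_mono[OF eventually_at_right_less])
  qed
  also have "\<dots> = ennreal (dens q)"
  proof (rule lim_imp_Liminf)
    show "((\<lambda>h. ennreal (dens (max 0 (q - h)))) \<longlongrightarrow> ennreal (dens q)) (at_right 0)"
    proof (cases "q = 0")
      case True
      have "\<forall>\<^sub>F h in at_right 0. ennreal (dens (max 0 (q - h))) = ennreal (dens q)"
        using True by (auto intro: eventually_mono[OF eventually_at_right_less])
      then show ?thesis by (rule tendsto_eventually)
    next
      case False
      have "((\<lambda>h. max 0 (q - h)) \<longlongrightarrow> max 0 (q - 0)) (at_right 0)"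
        by (intro tendsto_intros)
      then have "((\<lambda>h. max 0 (q - h)) \<longlongrightarrow> q) (at_right 0)" using q by simp
      then show ?thesis
        using continuous_dens[of q] False q by (intro tendsto_ennrealI isCont_tendsto_compose[of q dens]) auto
    qed
  qed simp
  finally show ?thesis .
qed

end

section \<open>Isoperimetry for the product measure\<close>

lemma vec_lambda_borel_measurable:
  assumes "\<And>i. sets (M i) = sets borel"
  shows "(vec_lambda :: _ \<Rightarrow> real ^ 'n) \<in> Pi\<^sub>M UNIV M \<rightarrow>\<^sub>M borel"
proof (subst borel_measurable_euclidean_space, intro ballI)
  fix b :: "real ^ 'n" assume "b \<in> Basis"
  then obtain i where b: "b = axis i 1" by (auto simp: Basis_vec_def)
  have "(\<lambda>f. f i) \<in> Pi\<^sub>M UNIV M \<rightarrow>\<^sub>M M i" by (rule measurable_component_singleton) simp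
  then have "(\<lambda>f. f i) \<in> Pi\<^sub>M UNIV M \<rightarrow>\<^sub>M borel" using measurable_cong_sets[OF refl assms] by blast
  then show "(\<lambda>f. ((\<chi> i. f i) :: real ^ 'n) \<bullet> b) \<in> borel_measurable (Pi\<^sub>M UNIV M)"
    by (simp add: b inner_axis)
qed

lemma dist_vec_upd: "dist (vec_lambda (z(k := s)) :: real ^ 'n) (vec_lambda (z(k := t))) = \<bar>s - t\<bar>"
proof -
  have "(\<Sum>i\<in>UNIV. (dist ((z(k := s)) i) ((z(k := t)) i))\<^sup>2) = (\<Sum>i\<in>UNIV. if i = k then (s - t)\<^sup>2 else 0)"
    by (intro sum.cong) (auto simp: dist_real_def)
  then show ?thesis by (simp add: dist_vec_def L2_set_def)
qed

text \<open>Moving a single coordinate is an isometry of the line into the space, so points close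
  within a section are close in the space.\<close>

lemma enlargement_section_subset:
  fixes A :: "(real ^ 'n) set"
  shows "enlargement {s. vec_lambda (z(k := s)) \<in> A} h \<subseteq> {s. vec_lambda (z(k := s)) \<in> enlargement A h}"
proof
  fix s assume "s \<in> enlargement {s. vec_lambda (z(k := s)) \<in> A} h"
  then obtain t where "vec_lambda (z(k := t)) \<in> A" "\<bar>t - s\<bar> < h"
    by (auto simp: enlargement_eq_Union_ball dist_real_def)
  then show "s \<in> {s. vec_lambda (z(k := s)) \<in> enlargement A h}"
    unfolding enlargement_eq_Union_ball mem_Collect_eq UN_iff mem_ball
    by (intro bexI[of _ "vec_lambda (z(k := t))"]) (simp_all only: dist_vec_upd)
qed

context convex_potential
begin

abbreviation mu_PiM :: "('n::finite \<Rightarrow> real) measure" where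
  "mu_PiM \<equiv> Pi\<^sub>M UNIV (\<lambda>_. mu \<Psi>)"

abbreviation vec_indicator :: "(real ^ 'n) set \<Rightarrow> ('n::finite \<Rightarrow> real) \<Rightarrow> ennreal" where
  "vec_indicator A z \<equiv> indicator A (vec_lambda z)"

lemma vec_measurable [measurable]: "(vec_lambda :: _ \<Rightarrow> real ^ 'n) \<in> mu_PiM \<rightarrow>\<^sub>M borel"
  by (rule vec_lambda_borel_measurable) simp

lemma prob_space_mu_prod: "prob_space (mu_prod \<Psi> :: (real ^ 'n) measure)"
  unfolding mu_prod_def by (intro prob_space.prob_space_distr prob_space_PiM_const vec_measurable)

lemma sets_mu_prod [simp, measurable_cong]: "sets (mu_prod \<Psi>) = sets borel"
  by (simp add: mu_prod_def)

lemma space_mu_prod [simp]: "space (mu_prod \<Psi>) = UNIV"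
  by (simp add: mu_prod_def)

lemma emeasure_mu_prod:
  fixes A :: "(real ^ 'n) set"
  assumes [measurable]: "A \<in> sets borel"
  shows "emeasure (mu_prod \<Psi>) A = (\<integral>\<^sup>+ z. vec_indicator A z \<partial>mu_PiM)"
proof -
  have "emeasure (mu_prod \<Psi>) A = (\<integral>\<^sup>+ x. indicator A x \<partial>mu_prod \<Psi>)" by simp
  also have "\<dots> = (\<integral>\<^sup>+ z. vec_indicator A z \<partial>mu_PiM)"
    unfolding mu_prod_def by (subst nn_integral_distr) auto
  finally show ?thesis .
qed

lemma emeasure_mu_prod_component:
  assumes [measurable]: "S \<in> sets borel"
  shows "emeasure (mu_prod \<Psi> :: (real ^ 'n) measure) {x. x $ k \<in> S} = emeasure (mu \<Psi>) S"
proof -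
  have [measurable]: "{x :: real ^ 'n. x $ k \<in> S} \<in> sets borel"
  proof -
    have "(\<lambda>x :: real ^ 'n. x $ k) \<in> borel_measurable borel"
      by (intro borel_measurable_continuous_onI continuous_intros)
    from measurable_sets[OF this assms] show ?thesis by (simp add: vimage_def)
  qed
  have "emeasure (mu_prod \<Psi> :: (real ^ 'n) measure) {x. x $ k \<in> S} =
      (\<integral>\<^sup>+ z. indicator S (z k) \<partial>(mu_PiM :: ('n \<Rightarrow> real) measure))"
    by (subst emeasure_mu_prod) (auto simp: indicator_def)
  also have "\<dots> = (\<integral>\<^sup>+ s. indicator S s \<partial>distr (mu_PiM :: ('n \<Rightarrow> real) measure) (mu \<Psi>) (\<lambda>z. z k))"
    by (subst nn_integral_distr) auto
  also have "distr (mu_PiM :: ('n \<Rightarrow> real) measure) (mu \<Psi>) (\<lambda>z. z k) = mu \<Psi>"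
    by (rule distr_PiM_component) (auto simp: prob)
  finally show ?thesis by simp
qed

lemma section_borel:
  fixes A :: "(real ^ 'n) set"
  assumes "A \<in> sets borel"
  shows "{s. vec_lambda (z(k := s)) \<in> A} \<in> sets borel"
proof -
  have "(\<lambda>s. vec_lambda (z(k := s)) :: real ^ 'n) \<in> borel_measurable borel"
  proof (intro borel_measurable_continuous_onI continuous_at_imp_continuous_on ballI)
    fix s show "isCont (\<lambda>s. vec_lambda (z(k := s)) :: real ^ 'n) s"
      unfolding continuous_at_eps_delta dist_vec_upd by (auto simp: dist_real_def)
  qed
  from measurable_sets[OF this assms] show ?thesis by (simp add: vimage_def)
qed

lemma coord_avg_vec_indicator:
  fixes A :: "(real ^ 'n) set"
  assumes "A \<in> sets borel"
  shows "coord_avg (mu \<Psi>) k (vec_indicator A) z = emeasure (mu \<Psi>) {s. vec_lambda (z(k := s)) \<in> A}"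
proof -
  have "coord_avg (mu \<Psi>) k (vec_indicator A) z = (\<integral>\<^sup>+ s. indicator {s. vec_lambda (z(k := s)) \<in> A} s \<partial>mu \<Psi>)"
    unfolding coord_avg_def by (intro nn_integral_cong) (auto simp: indicator_def)
  also have "\<dots> = emeasure (mu \<Psi>) {s. vec_lambda (z(k := s)) \<in> A}"
    using section_borel[OF assms] by (intro nn_integral_indicator) simp
  finally show ?thesis .
qed

text \<open>The sections of the enlargement contain the enlargements of the sections, so the
  one-dimensional bound can be integrated over all lines parallel to the \<open>k\<close>-th axis.\<close>

lemma emeasure_enlargement_direction:
  fixes A :: "(real ^ 'n) set"
  assumes A[measurable]: "A \<in> sets borel" and x: "0 \<le> x" and h: "0 < h" "h * hazard x \<le> 2"
    and w[measurable]: "w \<in> borel_measurable mu_PiM"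
    and le: "\<And>z. w z = 0 \<or> (\<exists>b. b = min (measure (mu \<Psi>) {s. vec_lambda (z(k := s)) \<in> A})
        (1 - measure (mu \<Psi>) {s. vec_lambda (z(k := s)) \<in> A}) \<and> b \<le> tail x \<and> w z \<le> ennreal b)"
  shows "emeasure (mu_prod \<Psi>) A + ennreal (h * hazard x / 4) * (\<integral>\<^sup>+ z. w z \<partial>mu_PiM)
    \<le> emeasure (mu_prod \<Psi>) (enlargement A h)"
proof -
  let ?sec = "\<lambda>z B. {s. (vec_lambda (z(k := s)) :: real ^ 'n) \<in> B}"
  note avg = coord_avg_measurable[OF _ UNIV_I]
  have mA: "vec_indicator B \<in> borel_measurable mu_PiM" if "B \<in> sets borel" for B :: "(real ^ 'n) set"
    using that by measurable
  have eq: "emeasure (mu_prod \<Psi>) B = (\<integral>\<^sup>+ z. coord_avg (mu \<Psi>) k (vec_indicator B) z \<partial>mu_PiM)"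
    if "B \<in> sets borel" for B :: "(real ^ 'n) set"
    unfolding emeasure_mu_prod[OF that] using mA[OF that] by (intro nn_integral_coord_avg[symmetric]) auto
  have "emeasure (mu_prod \<Psi>) A + ennreal (h * hazard x / 4) * (\<integral>\<^sup>+ z. w z \<partial>mu_PiM) =
      (\<integral>\<^sup>+ z. coord_avg (mu \<Psi>) k (vec_indicator A) z + ennreal (h * hazard x / 4) * w z \<partial>mu_PiM)"
    using avg[OF mA[OF A]] by (simp add: eq nn_integral_add nn_integral_cmult)
  also have "\<dots> \<le> (\<integral>\<^sup>+ z. coord_avg (mu \<Psi>) k (vec_indicator (enlargement A h)) z \<partial>mu_PiM)"
  proof (intro nn_integral_mono)
    fix z :: "'n \<Rightarrow> real"
    let ?B = "?sec z A"
    have B: "?B \<in> sets borel" by (rule section_borel[OF A])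
    have "emeasure (mu \<Psi>) ?B + ennreal (h * hazard x / 4) * w z \<le> emeasure (mu \<Psi>) (enlargement ?B h)"
      using le[of z]
    proof (elim disjE exE conjE)
      assume "w z = 0"
      then show ?thesis using subset_enlargement[OF h(1), of ?B] by (simp add: emeasure_mono)
    next
      fix b assume b: "b = min (measure (mu \<Psi>) ?B) (1 - measure (mu \<Psi>) ?B)" "b \<le> tail x" "w z \<le> ennreal b"
      have b0: "0 \<le> b" using b(1) prob_le_1[of ?B] by simp
      have hh: "0 \<le> h * hazard x / 4" using h hazard_pos[of x] by simp
      have "emeasure (mu \<Psi>) ?B + ennreal (h * hazard x / 4) * w z \<le>
          ennreal (measure (mu \<Psi>) ?B) + ennreal (h * hazard x / 4) * ennreal b"
        using b by (intro add_mono mult_left_mono) (auto simp: emeasure_eq_measure)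
      also have "\<dots> = ennreal (measure (mu \<Psi>) ?B + h * hazard x / 4 * b)"
        using b0 hh by (simp only: ennreal_mult ennreal_plus measure_nonneg mult_nonneg_nonneg)
      also have "\<dots> \<le> ennreal (measure (mu \<Psi>) (enlargement ?B h))"
        by (intro ennreal_leI measure_enlargement_ge[OF B x h b(1,2)])
      finally show ?thesis by (simp add: emeasure_eq_measure)
    qed
    also have "\<dots> \<le> emeasure (mu \<Psi>) (?sec z (enlargement A h))"
      using section_borel[OF enlargement_borel]
      by (intro emeasure_mono enlargement_section_subset) simp
    finally show "coord_avg (mu \<Psi>) k (vec_indicator A) z + ennreal (h * hazard x / 4) * w z
        \<le> coord_avg (mu \<Psi>) k (vec_indicator (enlargement A h)) z"
      by (simp add: coord_avg_vec_indicator A)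
  qed
  also have "\<dots> = emeasure (mu_prod \<Psi>) (enlargement A h)" by (simp add: eq)
  finally show ?thesis .
qed

text \<open>Adds the bounds for all \<open>n\<close> directions and divides by \<open>n\<close>.
  Only the sum over the directions of the weight integrals has to be bounded below, not the integral
  for any single one.\<close>

lemma measure_enlargement_sum:
  fixes A :: "(real ^ 'n) set" and w :: "'n \<Rightarrow> ('n \<Rightarrow> real) \<Rightarrow> ennreal"
  assumes A[measurable]: "A \<in> sets borel" and x: "0 \<le> x" and h: "0 < h" "h * hazard x \<le> 2"
    and w: "\<And>k. w k \<in> borel_measurable mu_PiM"
    and le: "\<And>k z. w k z = 0 \<or> (\<exists>b. b = min (measure (mu \<Psi>) {s. vec_lambda (z(k := s)) \<in> A})
        (1 - measure (mu \<Psi>) {s. vec_lambda (z(k := s)) \<in> A}) \<and> b \<le> tail x \<and> w k z \<le> ennreal b)"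
    and W: "ennreal W \<le> (\<Sum>k\<in>UNIV. \<integral>\<^sup>+ z. w k z \<partial>mu_PiM)" "0 \<le> W"
  shows "measure (mu_prod \<Psi>) A + h * (hazard x * W / (4 * CARD('n))) \<le> measure (mu_prod \<Psi>) (enlargement A h)"
proof -
  interpret P: prob_space "mu_prod \<Psi> :: (real ^ 'n) measure" by (rule prob_space_mu_prod)
  define n where "n = real CARD('n)"
  have n: "0 < n" by (simp add: n_def)
  have hh: "0 \<le> h * hazard x / 4" using h hazard_pos[of x] by simp
  have "ennreal (n * measure (mu_prod \<Psi>) A + h * hazard x / 4 * W) =
      of_nat CARD('n) * emeasure (mu_prod \<Psi>) A + ennreal (h * hazard x / 4) * ennreal W"
    using W hh n by (simp only: ennreal_mult ennreal_plus measure_nonneg mult_nonneg_nonneg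
        P.emeasure_eq_measure n_def ennreal_of_nat_eq_real_of_nat of_nat_0_le_iff)
  also have "\<dots> \<le> of_nat CARD('n) * emeasure (mu_prod \<Psi>) A
      + ennreal (h * hazard x / 4) * (\<Sum>k\<in>UNIV. \<integral>\<^sup>+ z. w k z \<partial>mu_PiM)"
    by (intro add_left_mono mult_left_mono W) simp
  also have "\<dots> = (\<Sum>k\<in>(UNIV :: 'n set). emeasure (mu_prod \<Psi>) A + ennreal (h * hazard x / 4) * (\<integral>\<^sup>+ z. w k z \<partial>mu_PiM))"
    by (simp add: sum.distrib sum_distrib_left)
  also have "\<dots> \<le> (\<Sum>k\<in>(UNIV :: 'n set). emeasure (mu_prod \<Psi>) (enlargement A h))"
    by (intro sum_mono emeasure_enlargement_direction[OF A x h w le])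
  also have "\<dots> = ennreal (n * measure (mu_prod \<Psi>) (enlargement A h))"
    by (simp add: P.emeasure_eq_measure n_def ennreal_of_nat_eq_real_of_nat ennreal_mult)
  finally have "n * measure (mu_prod \<Psi>) A + h * hazard x / 4 * W \<le> n * measure (mu_prod \<Psi>) (enlargement A h)"
    using n by (subst (asm) ennreal_le_iff) auto
  then have "measure (mu_prod \<Psi>) A + (h * hazard x / 4 * W) / n \<le> measure (mu_prod \<Psi>) (enlargement A h)"
    using n by (simp add: field_simps)
  then show ?thesis by (simp add: n_def mult.assoc)
qed

text \<open>By assumption at most half of the mass of \<open>A\<close> sits where all sections are
  long. Every other point of \<open>A\<close> has a section of measure at most \<open>s\<close> in
  some direction, so summing over the directions recovers the remaining half.\<close>

lemma small_sections_mass: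
  fixes A :: "(real ^ 'n) set"
  assumes A[measurable]: "A \<in> sets borel" and s: "s \<le> 1 / 2"
    and le: "(\<integral>\<^sup>+ z. vec_indicator A z * indicator {z. \<forall>k\<in>UNIV. ennreal s < coord_avg (mu \<Psi>) k (vec_indicator A) z} z \<partial>mu_PiM)
      \<le> ennreal (1 / 2) * (\<integral>\<^sup>+ z. vec_indicator A z \<partial>mu_PiM)"
  shows "ennreal (measure (mu_prod \<Psi>) A / 2) \<le>
    (\<Sum>k\<in>UNIV. \<integral>\<^sup>+ z. coord_avg (mu \<Psi>) k (vec_indicator A) z *
        indicator {z. coord_avg (mu \<Psi>) k (vec_indicator A) z \<le> ennreal s} z \<partial>mu_PiM)"
proof -
  interpret P: prob_space "mu_prod \<Psi> :: (real ^ 'n) measure" by (rule prob_space_mu_prod)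
  let ?f = "vec_indicator A" and ?a = "\<lambda>k. coord_avg (mu \<Psi>) k (vec_indicator A)"
  let ?G = "{z. \<forall>k\<in>UNIV. ennreal s < ?a k z}"
  let ?S = "\<lambda>k. {z. ?a k z \<le> ennreal s}"
  have f[measurable]: "?f \<in> borel_measurable mu_PiM" by measurable
  have a[measurable]: "?a k \<in> borel_measurable mu_PiM" for k
    by (rule coord_avg_measurable[OF f UNIV_I])
  have ind[measurable]: "(\<lambda>z. indicator (?S k) z :: ennreal) \<in> borel_measurable mu_PiM" for k
    unfolding indicator_def by measurable
  have G[measurable]: "(\<lambda>z. indicator ?G z :: ennreal) \<in> borel_measurable mu_PiM"
    unfolding indicator_def by measurable
  \<comment> \<open>Whether the section in direction \<open>k\<close> is short does not depend on
    coordinate \<open>k\<close>, so the indicator of \<open>A\<close> may be exchanged for its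
    average.\<close>
  have swap: "(\<integral>\<^sup>+ z. ?a k z * indicator (?S k) z \<partial>mu_PiM) = (\<integral>\<^sup>+ z. ?f z * indicator (?S k) z \<partial>mu_PiM)" for k
    by (rule nn_integral_mult_coord_avg[OF f _ ind]) (simp_all add: indicator_def coord_avg_upd_same del: fun_upd_apply)
  define t where "t = measure (mu_prod \<Psi>) A"
  have t: "(\<integral>\<^sup>+ z. ?f z \<partial>mu_PiM) = ennreal t"
    by (simp add: t_def flip: emeasure_mu_prod P.emeasure_eq_measure)
  have "ennreal t \<le> (\<integral>\<^sup>+ z. ?f z * indicator ?G z + (\<Sum>k\<in>UNIV. ?f z * indicator (?S k) z) \<partial>mu_PiM)"
    unfolding t[symmetric]
  proof (intro nn_integral_mono)
    fix z :: "'n \<Rightarrow> real"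
    show "?f z \<le> ?f z * indicator ?G z + (\<Sum>k\<in>UNIV. ?f z * indicator (?S k) z)"
    proof (cases "z \<in> ?G")
      case False
      then obtain k where "z \<in> ?S k" by (auto simp: not_less)
      then have "?f z = ?f z * indicator (?S k) z" by simp
      also have "\<dots> \<le> (\<Sum>k\<in>UNIV. ?f z * indicator (?S k) z)"
        by (rule member_le_sum) auto
      finally show ?thesis by (simp add: add_increasing)
    qed simp
  qed
  also have "\<dots> = (\<integral>\<^sup>+ z. ?f z * indicator ?G z \<partial>mu_PiM) + (\<Sum>k\<in>UNIV. \<integral>\<^sup>+ z. ?f z * indicator (?S k) z \<partial>mu_PiM)"
    using f ind G by (simp only: nn_integral_add nn_integral_sum borel_measurable_times_ennreal borel_measurable_sum)
  also have "\<dots> \<le> ennreal (1 / 2) * ennreal t + (\<Sum>k\<in>UNIV. \<integral>\<^sup>+ z. ?f z * indicator (?S k) z \<partial>mu_PiM)"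
    using le unfolding t by (intro add_right_mono)
  also have "ennreal (1 / 2) * ennreal t = ennreal (t / 2)"
    by (subst ennreal_mult[symmetric]) (auto simp: t_def)
  finally have "ennreal (t / 2) + ennreal (t / 2) \<le>
      ennreal (t / 2) + (\<Sum>k\<in>UNIV. \<integral>\<^sup>+ z. ?f z * indicator (?S k) z \<partial>mu_PiM)"
    by (simp add: t_def flip: ennreal_plus)
  then show ?thesis unfolding swap t_def[symmetric] by (simp add: ennreal_add_left_cancel_le)
qed

text \<open>The Efron--Stein bound for \<open>A\<close> and its complement, combined with
  \<open>t * (1 - t) \<ge> t / 2\<close> for \<open>t \<le> 1/2\<close>.\<close>

lemma cut_sections_mass:
  fixes A :: "(real ^ 'n) set"
  assumes A[measurable]: "A \<in> sets borel" and half: "measure (mu_prod \<Psi>) A \<le> 1 / 2"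
  shows "ennreal (measure (mu_prod \<Psi>) A / 2) \<le>
    (\<Sum>k\<in>UNIV. \<integral>\<^sup>+ z. coord_avg (mu \<Psi>) k (vec_indicator A) z *
        coord_avg (mu \<Psi>) k (vec_indicator (- A)) z \<partial>mu_PiM)"
proof -
  interpret P: prob_space "mu_prod \<Psi> :: (real ^ 'n) measure" by (rule prob_space_mu_prod)
  define t where "t = measure (mu_prod \<Psi>) A"
  have "measure (mu_prod \<Psi>) (- A) = 1 - t"
    using P.prob_compl[of A] by (simp add: t_def Compl_eq_Diff_UNIV)
  have "ennreal (t / 2) \<le> ennreal (t * (1 - t))"
    using half mult_left_mono[of "1 / 2" "1 - t" t] by (intro ennreal_leI) (simp add: t_def)
  also have "\<dots> = emeasure (mu_prod \<Psi>) A * emeasure (mu_prod \<Psi>) (- A)"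
    using \<open>measure (mu_prod \<Psi>) (- A) = 1 - t\<close> half
    by (simp add: P.emeasure_eq_measure ennreal_mult t_def)
  also have "\<dots> = (\<integral>\<^sup>+ z. vec_indicator A z \<partial>mu_PiM) * (\<integral>\<^sup>+ z. vec_indicator (- A) z \<partial>mu_PiM)"
    by (simp add: emeasure_mu_prod)
  also have "\<dots> \<le> (\<Sum>k\<in>UNIV. \<integral>\<^sup>+ z. coord_avg (mu \<Psi>) k (vec_indicator A) z *
        coord_avg (mu \<Psi>) k (vec_indicator (- A)) z \<partial>mu_PiM)"
    by (intro variance_le_sum_coord_avg) (auto simp: indicator_def)
  finally show ?thesis by (simp add: t_def)
qed

text \<open>The weight is the section measure, cut off to 0 above \<open>tail x\<close>. Since
  \<open>tail x \<le> 1/2\<close>, below the cutoff it is the smaller one of the measures of the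
  section and its complement.\<close>

lemma measure_enlargement_small:
  fixes A :: "(real ^ 'n) set"
  assumes A[measurable]: "A \<in> sets borel" and x: "0 \<le> x" and h: "0 < h" "h * hazard x \<le> 2"
    and le: "(\<integral>\<^sup>+ z. vec_indicator A z * indicator {z. \<forall>k\<in>UNIV. ennreal (tail x) < coord_avg (mu \<Psi>) k (vec_indicator A) z} z \<partial>mu_PiM)
      \<le> ennreal (1 / 2) * (\<integral>\<^sup>+ z. vec_indicator A z \<partial>mu_PiM)"
  shows "measure (mu_prod \<Psi>) A + h * (hazard x * (measure (mu_prod \<Psi>) A / 2) / (4 * CARD('n)))
    \<le> measure (mu_prod \<Psi>) (enlargement A h)"
proof -
  let ?a = "\<lambda>k. coord_avg (mu \<Psi>) k (vec_indicator A)"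
  let ?w = "\<lambda>k z. ?a k z * indicator {z. ?a k z \<le> ennreal (tail x)} z"
  have s: "tail x \<le> 1 / 2" using tail_antimono[OF x] by (simp add: tail_zero)
  have f: "vec_indicator A \<in> borel_measurable mu_PiM" by measurable
  have a[measurable]: "?a k \<in> borel_measurable mu_PiM" for k
    by (rule coord_avg_measurable[OF f UNIV_I])
  show ?thesis
  proof (rule measure_enlargement_sum[OF A x h, of ?w])
    show "?w k \<in> borel_measurable mu_PiM" for k
      unfolding indicator_def by measurable
    show "ennreal (measure (mu_prod \<Psi>) A / 2) \<le> (\<Sum>k\<in>UNIV. \<integral>\<^sup>+ z. ?w k z \<partial>mu_PiM)"
      by (rule small_sections_mass[OF A s le])
    fix k z
    let ?B = "{s. vec_lambda (z(k := s)) \<in> A}"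
    have a: "?a k z = ennreal (measure (mu \<Psi>) ?B)"
      by (simp add: coord_avg_vec_indicator[OF A] emeasure_eq_measure)
    show "?w k z = 0 \<or> (\<exists>b. b = min (measure (mu \<Psi>) ?B) (1 - measure (mu \<Psi>) ?B) \<and> b \<le> tail x \<and> ?w k z \<le> ennreal b)"
    proof (cases "measure (mu \<Psi>) ?B \<le> tail x")
      case True
      then have "min (measure (mu \<Psi>) ?B) (1 - measure (mu \<Psi>) ?B) = measure (mu \<Psi>) ?B"
        using s by linarith
      moreover have "?w k z \<le> ?a k z" by (simp split: split_indicator)
      ultimately show ?thesis using True unfolding a by (intro disjI2) simp
    next
      case False
      then have out: "z \<notin> {z. ?a k z \<le> ennreal (tail x)}"
        unfolding mem_Collect_eq a by simp
      then show ?thesis by (intro disjI1) (simp only: indicator_simps(2)[OF out] mult_zero_right)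
    qed
  qed simp
qed

text \<open>The weight is \<open>m * (1 - m)\<close> for a section of measure \<open>m\<close>. It
  is at most \<open>min m (1 - m)\<close>, which never exceeds \<open>1/2 = tail 0\<close>, so no
  section has to be discarded if the hazard rate is taken at 0.\<close>

lemma measure_enlargement_large:
  fixes A :: "(real ^ 'n) set"
  assumes A[measurable]: "A \<in> sets borel" and h: "0 < h" "h * hazard 0 \<le> 2"
    and half: "measure (mu_prod \<Psi>) A \<le> 1 / 2"
  shows "measure (mu_prod \<Psi>) A + h * (hazard 0 * (measure (mu_prod \<Psi>) A / 2) / (4 * CARD('n)))
    \<le> measure (mu_prod \<Psi>) (enlargement A h)"
proof -
  let ?a = "\<lambda>k. coord_avg (mu \<Psi>) k (vec_indicator A)"
  let ?a' = "\<lambda>k. coord_avg (mu \<Psi>) k (vec_indicator (- A))"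
  have f: "vec_indicator B \<in> borel_measurable mu_PiM" if "B \<in> sets borel" for B :: "(real ^ 'n) set"
    using that by measurable
  have a[measurable]: "?a k \<in> borel_measurable mu_PiM" "?a' k \<in> borel_measurable mu_PiM" for k
    by (intro coord_avg_measurable[OF _ UNIV_I] f; simp)+
  show ?thesis
  proof (rule measure_enlargement_sum[OF A order_refl h, of "\<lambda>k z. ?a k z * ?a' k z"])
    show "(\<lambda>z. ?a k z * ?a' k z) \<in> borel_measurable mu_PiM" for k by measurable
    show "ennreal (measure (mu_prod \<Psi>) A / 2) \<le> (\<Sum>k\<in>UNIV. \<integral>\<^sup>+ z. ?a k z * ?a' k z \<partial>mu_PiM)"
      by (rule cut_sections_mass[OF A half])
    fix k z
    let ?B = "{s. vec_lambda (z(k := s)) \<in> A}"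
    have B: "?B \<in> sets borel" by (rule section_borel[OF A])
    define m where "m = measure (mu \<Psi>) ?B"
    have m: "0 \<le> m" "m \<le> 1" by (auto simp: m_def)
    have "measure (mu \<Psi>) (- ?B) = 1 - m"
      using prob_compl[of ?B] B by (simp add: m_def Compl_eq_Diff_UNIV)
    moreover have "{s. vec_lambda (z(k := s)) \<in> - A} = - ?B" by auto
    ultimately have "?a k z * ?a' k z = ennreal (m * (1 - m))"
      using m by (simp add: coord_avg_vec_indicator A emeasure_eq_measure ennreal_mult m_def del: ComplI Compl_iff)
    moreover have "m * (1 - m) \<le> min m (1 - m)"
      using m mult_left_mono[of "1 - m" 1 m] mult_right_mono[of m 1 "1 - m"] by simp
    moreover have "min m (1 - m) \<le> 1 / 2" by linarith
    ultimately show "?a k z * ?a' k z = 0 \<or> (\<exists>b. b = min (measure (mu \<Psi>) ?B) (1 - measure (mu \<Psi>) ?B)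
        \<and> b \<le> tail 0 \<and> ?a k z * ?a' k z \<le> ennreal b)"
      by (intro disjI2) (auto simp: tail_zero ennreal_leI simp flip: m_def)
  qed simp
qed

text \<open>Since \<open>dens y = hazard y * tail y\<close>, it suffices to gain a multiple of
  \<open>hazard x * tail y\<close> at a point \<open>x\<close> with \<open>hazard x\<close>
  comparable to \<open>hazard y\<close>. For small measures \<open>x\<close> comes from the short
  sections; otherwise \<open>y\<close> stays in a bounded interval and \<open>x = 0\<close> will
  do.\<close>

lemma product_enlargement_ge:
  "\<exists>c>0. \<forall>A y. A \<in> sets borel \<longrightarrow> 0 \<le> y \<longrightarrow> measure (mu_prod \<Psi> :: (real ^ 'n) measure) A = tail y \<longrightarrow>
    (\<exists>h0>0. \<forall>h. 0 < h \<longrightarrow> h < h0 \<longrightarrow>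
      tail y + h * (c * dens y) \<le> measure (mu_prod \<Psi> :: (real ^ 'n) measure) (enlargement A h))"
proof -
  interpret P: prob_space "mu_prod \<Psi> :: (real ^ 'n) measure" by (rule prob_space_mu_prod)
  let ?n = "CARD('n)"
  obtain x0 where x0: "0 < x0" "1 \<le> \<Psi> x0" using Psi_unbounded by blast
  have "0 < (1 / 2 :: real)" by simp
  from small_average_of_small_integral[of "UNIV :: 'n set", OF finite_class.finite_UNIV this] obtain \<kappa> where
    k: "0 < \<kappa>" and small: "\<And>f s. f \<in> borel_measurable (mu_PiM :: ('n \<Rightarrow> real) measure) \<Longrightarrow>
    (\<forall>x\<in>space mu_PiM. f x = 0 \<or> f x = 1) \<Longrightarrow> 0 < s \<Longrightarrow>
    (\<integral>\<^sup>+ x. f x \<partial>mu_PiM) \<le> ennreal (\<kappa> * s ^ ?n) \<Longrightarrow>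
    (\<integral>\<^sup>+ x. f x * indicator {x. \<forall>i\<in>UNIV. ennreal s < coord_avg (mu \<Psi>) i f x} x \<partial>mu_PiM)
      \<le> ennreal (1 / 2) * (\<integral>\<^sup>+ x. f x \<partial>mu_PiM)"
    by blast
  from hazard_comparison[OF k x0, of ?n] obtain C where
    C: "0 < C" "\<And>x y. x0 \<le> x \<Longrightarrow> 0 \<le> y \<Longrightarrow> \<kappa> * tail x ^ ?n \<le> tail y \<Longrightarrow> hazard y \<le> C * hazard x"
    by blast
  \<comment> \<open>Measures up to \<open>t0\<close> correspond to points \<open>x \<ge> x0\<close>,
    where the hazard rates can be compared.\<close>
  define t0 where "t0 = \<kappa> * tail x0 ^ ?n"
  have t0: "0 < t0" using k tail_pos[of x0] by (simp add: t0_def)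
  obtain y0 where y0: "0 \<le> y0" "tail y0 = min t0 (1 / 2)"
  proof -
    have "0 < min t0 (1 / 2)" "min t0 (1 / 2) \<le> 1 / 2" using t0 by (simp, linarith)
    from tail_surj[OF this] that show ?thesis by blast
  qed
  \<comment> \<open>The minimum covers the two regimes; 8 combines the half of the mass used in
    either case with the 4 of the one-dimensional bound.\<close>
  define c where "c = min (1 / C) (hazard 0 / hazard y0) / (8 * real ?n)"
  have c: "0 < c" using C(1) hazard_pos by (simp add: c_def)
  show ?thesis
  proof (rule exI[of _ c], intro conjI allI impI c)
    fix A :: "(real ^ 'n) set" and y
    assume A[measurable]: "A \<in> sets borel" and y: "0 \<le> y" and Ay: "measure (mu_prod \<Psi>) A = tail y"
    have half: "tail y \<le> 1 / 2" using tail_antimono[OF y] by (simp add: tail_zero)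
    have "\<exists>x\<ge>0. min (1 / C) (hazard 0 / hazard y0) * hazard y \<le> hazard x \<and>
      (\<forall>h. 0 < h \<longrightarrow> h * hazard x \<le> 2 \<longrightarrow>
        tail y + h * (hazard x * (tail y / 2) / (4 * ?n)) \<le> measure (mu_prod \<Psi>) (enlargement A h))"
    proof (cases "tail y \<le> t0")
      case True
      \<comment> \<open>The section length for which the smallness condition
        \<open>\<kappa> * s ^ n\<close> on the mass holds with equality.\<close>
      define s where "s = root ?n (tail y / \<kappa>)"
      have s: "0 < s" using tail_pos[of y] k by (simp add: s_def)
      have sn: "\<kappa> * s ^ ?n = tail y" using tail_pos[of y] k by (simp add: s_def real_root_pow_pos2)
      have "\<kappa> * s ^ ?n \<le> \<kappa> * tail x0 ^ ?n" using True by (simp only: sn t0_def)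
      then have "s ^ ?n \<le> tail x0 ^ ?n" using k by simp
      then have sx0: "s \<le> tail x0" 
        using tail_nonneg[of x0] zero_less_card_finite by (meson not_le power_strict_mono)
      moreover have "tail x0 \<le> 1 / 2" using tail_antimono[of 0 x0] x0 by (simp add: tail_zero)
      ultimately obtain x where x: "0 \<le> x" "tail x = s" using tail_surj[of s] s by auto
      have "x0 \<le> x" using sx0 x tail_le_iff[of x x0] by simp
      then have "hazard y \<le> C * hazard x" using y x sn by (intro C(2)) auto
      then have "1 / C * hazard y \<le> hazard x" using C(1) by (simp add: field_simps)
      moreover have "min (1 / C) (hazard 0 / hazard y0) * hazard y \<le> 1 / C * hazard y"
        using hazard_pos[of y] by (intro mult_right_mono) auto
      ultimately have "min (1 / C) (hazard 0 / hazard y0) * hazard y \<le> hazard x" by linarith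
      moreover have "(\<integral>\<^sup>+ z. vec_indicator A z * indicator {z. \<forall>k\<in>UNIV. ennreal (tail x) < coord_avg (mu \<Psi>) k (vec_indicator A) z} z \<partial>mu_PiM)
          \<le> ennreal (1 / 2) * (\<integral>\<^sup>+ z. vec_indicator A z \<partial>mu_PiM)"
        using s sn x by (intro small)
          (simp_all add: sn Ay P.emeasure_eq_measure split: split_indicator flip: emeasure_mu_prod)
      ultimately show ?thesis
        using measure_enlargement_small[OF A x(1)] x(1) by (auto simp: Ay)
    next
      case False
      then have "y \<le> y0" using y0(2) tail_le_iff[of y0 y] by linarith
      then have "hazard y \<le> hazard y0" using y by (intro hazard_mono)
      then have "hazard 0 / hazard y0 * hazard y \<le> hazard 0"
        using hazard_pos[of 0] hazard_pos[of y0] by (simp add: field_simps)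
      moreover have "min (1 / C) (hazard 0 / hazard y0) * hazard y \<le> hazard 0 / hazard y0 * hazard y"
        using hazard_pos[of y] by (intro mult_right_mono) auto
      ultimately have "min (1 / C) (hazard 0 / hazard y0) * hazard y \<le> hazard 0" by linarith
      then show ?thesis using measure_enlargement_large[OF A] half by (auto simp: Ay)
    qed
    then obtain x where x: "0 \<le> x" "min (1 / C) (hazard 0 / hazard y0) * hazard y \<le> hazard x"
      and ge: "\<And>h. 0 < h \<Longrightarrow> h * hazard x \<le> 2 \<Longrightarrow>
        tail y + h * (hazard x * (tail y / 2) / (4 * ?n)) \<le> measure (mu_prod \<Psi>) (enlargement A h)"
      by blast
    have "c * dens y \<le> hazard x * (tail y / 2) / (4 * ?n)"
      using mult_right_mono[OF x(2), of "tail y / (8 * ?n)"]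
      by (simp add: dens_eq_hazard c_def field_simps)
    then have "tail y + h * (c * dens y) \<le> measure (mu_prod \<Psi>) (enlargement A h)"
      if "0 < h" "h < 2 / hazard x" for h
    proof -
      have "h * (c * dens y) \<le> h * (hazard x * (tail y / 2) / (4 * ?n))"
        using that \<open>c * dens y \<le> _\<close> by (intro mult_left_mono) auto
      moreover have "h * hazard x \<le> 2" using that hazard_pos[of x] by (simp add: field_simps)
      ultimately show ?thesis using ge[of h] that by linarith
    qed
    then show "\<exists>h0>0. \<forall>h. 0 < h \<longrightarrow> h < h0 \<longrightarrow>
      tail y + h * (c * dens y) \<le> measure (mu_prod \<Psi>) (enlargement A h)"
      using hazard_pos[of x] by (intro exI[of _ "2 / hazard x"]) auto
  qed
qed

section \<open>Lower bound for the profile of the product measure\<close>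

lemma isoperimetric_profile_product_ge:
  "\<exists>c>0. \<forall>y\<ge>0. ennreal (c * dens y) \<le> isoperimetric_profile (mu_prod \<Psi> :: (real ^ 'n) measure) (ennreal (tail y))"
proof -
  interpret P: prob_space "mu_prod \<Psi> :: (real ^ 'n) measure" by (rule prob_space_mu_prod)
  obtain c where c: "0 < c" and ge: "\<And>A y. A \<in> sets borel \<Longrightarrow> 0 \<le> y \<Longrightarrow>
    measure (mu_prod \<Psi> :: (real ^ 'n) measure) A = tail y \<Longrightarrow>
    \<exists>h0>0. \<forall>h. 0 < h \<longrightarrow> h < h0 \<longrightarrow>
      tail y + h * (c * dens y) \<le> measure (mu_prod \<Psi> :: (real ^ 'n) measure) (enlargement A h)"
    using product_enlargement_ge by blast
  have "ennreal (c * dens y) \<le> boundary_measure (mu_prod \<Psi>) A"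
    if y: "0 \<le> y" and A: "A \<in> sets borel" "emeasure (mu_prod \<Psi>) A = ennreal (tail y)" for y and A :: "(real ^ 'n) set"
  proof -
    have "measure (mu_prod \<Psi>) A = tail y" using A(2) by (simp add: P.emeasure_eq_measure)
    from ge[OF A(1) y this] obtain h0 where h0: "0 < h0" "\<And>h. 0 < h \<Longrightarrow> h < h0 \<Longrightarrow>
      tail y + h * (c * dens y) \<le> measure (mu_prod \<Psi>) (enlargement A h)" by blast
    have "ennreal (c * dens y) \<le> (emeasure (mu_prod \<Psi>) (enlargement A h) - emeasure (mu_prod \<Psi>) A) / ennreal h"
      if h: "0 < h" "h < h0" for h
    proof -
      have "ennreal (h * (c * dens y)) \<le> ennreal (measure (mu_prod \<Psi>) (enlargement A h) - tail y)"
        using h0(2)[OF h] by (intro ennreal_leI) simp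
      also have "\<dots> = emeasure (mu_prod \<Psi>) (enlargement A h) - emeasure (mu_prod \<Psi>) A"
        unfolding A(2) by (simp add: P.emeasure_eq_measure ennreal_minus)
      finally have "ennreal (h * (c * dens y)) / ennreal h \<le>
          (emeasure (mu_prod \<Psi>) (enlargement A h) - emeasure (mu_prod \<Psi>) A) / ennreal h"
        by (rule divide_right_mono_ennreal)
      then show ?thesis using h c by (simp add: divide_ennreal)
    qed
    then have "\<forall>\<^sub>F h in at_right 0. ennreal (c * dens y) \<le>
        (emeasure (mu_prod \<Psi>) (enlargement A h) - emeasure (mu_prod \<Psi>) A) / ennreal h"
      unfolding eventually_at_right_field using h0(1) by blast
    then show ?thesis unfolding boundary_measure_def by (rule Liminf_bounded)
  qed
  then have "\<forall>y\<ge>0. ennreal (c * dens y) \<le> isoperimetric_profile (mu_prod \<Psi> :: (real ^ 'n) measure) (ennreal (tail y))"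
    unfolding isoperimetric_profile_def by (auto intro!: INF_greatest)
  then show ?thesis using c by blast
qed

end

section \<open>Rearrangements and the weight\<close>

lemma measure_superlevel_antimono:
  fixes g :: "real \<Rightarrow> real"
  assumes g: "g \<in> borel_measurable (lebesgue_on {0..1})" and "s \<le> t"
  shows "measure (lebesgue_on {0..1}) {x\<in>{0..1}. \<bar>g x\<bar> > t} \<le> measure (lebesgue_on {0..1}) {x\<in>{0..1}. \<bar>g x\<bar> > s}"
proof -
  interpret finite_measure "lebesgue_on {0..1::real}"
    by (rule finite_measure_lebesgue_on) simp
  have "{x\<in>space (lebesgue_on {0..1}). \<bar>g x\<bar> > s} \<in> sets (lebesgue_on {0..1})"
    using g by measurable
  then show ?thesis using assms(2) by (intro finite_measure_mono) auto
qed

text \<open>Since \<open>g\<close> is real-valued, its superlevel sets decrease to the empty set and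
  their measures tend to 0. Without this the infimum in \<open>rearrangement\<close> would carry no
  information.\<close>

lemma rearrangement_set_nonempty:
  fixes g :: "real \<Rightarrow> real"
  assumes g: "g \<in> borel_measurable (lebesgue_on {0..1})" and s: "0 < s"
  shows "{t. 0 \<le> t \<and> measure (lebesgue_on {0..1}) {x\<in>{0..1}. \<bar>g x\<bar> > t} \<le> s} \<noteq> {}"
proof -
  interpret finite_measure "lebesgue_on {0..1::real}"
    by (rule finite_measure_lebesgue_on) simp
  let ?A = "\<lambda>n. {x\<in>{0..1}. \<bar>g x\<bar> > real n}"
  have "{x\<in>space (lebesgue_on {0..1}). \<bar>g x\<bar> > real n} \<in> sets (lebesgue_on {0..1})" for n
    using g by measurable
  then have "(\<lambda>n. measure (lebesgue_on {0..1}) (?A n)) \<longlonglongrightarrow> measure (lebesgue_on {0..1}) (\<Inter>n. ?A n)"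
    by (intro finite_Lim_measure_decseq) (auto simp: decseq_def)
  moreover have "(\<Inter>n. ?A n) = {}"
    using less_asym reals_Archimedean2 by fastforce
  ultimately have "(\<lambda>n. measure (lebesgue_on {0..1}) (?A n)) \<longlonglongrightarrow> 0" by simp
  from order_tendstoD(2)[OF this s] obtain n where "measure (lebesgue_on {0..1}) (?A n) < s"
    by (auto dest: eventually_happens)
  then show ?thesis by (auto intro!: exI[of _ "real n"])
qed

lemma rearrangement_nonneg:
  assumes "g \<in> borel_measurable (lebesgue_on {0..1})" "0 < s"
  shows "0 \<le> rearrangement g s"
  unfolding rearrangement_def using rearrangement_set_nonempty[OF assms] by (intro cInf_greatest) auto

lemma rearrangement_antimono:
  assumes "g \<in> borel_measurable (lebesgue_on {0..1})" "0 < s" "s \<le> t"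
  shows "rearrangement g t \<le> rearrangement g s"
  unfolding rearrangement_def using rearrangement_set_nonempty[OF assms(1,2)] assms(3)
  by (intro cInf_superset_mono) (auto intro: bdd_belowI[of _ 0])

text \<open>If the value were 0, every set where \<open>g\<close> exceeds some
  \<open>1 / (n + 1)\<close> in absolute value would have measure at most \<open>s\<close>. These
  sets increase to a set of full measure, contradicting \<open>s < 1\<close>.\<close>

lemma rearrangement_pos:
  fixes g :: "real \<Rightarrow> real"
  assumes g: "g \<in> borel_measurable (lebesgue_on {0..1})" and pos: "AE s in lebesgue_on {0..1}. g s > 0"
    and s: "0 < s" "s < 1"
  shows "0 < rearrangement g s"
proof (rule ccontr)
  interpret finite_measure "lebesgue_on {0..1::real}"
    by (rule finite_measure_lebesgue_on) simp
  let ?m = "measure (lebesgue_on {0..1::real})"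
  let ?S = "{t. 0 \<le> t \<and> ?m {x\<in>{0..1}. \<bar>g x\<bar> > t} \<le> s}"
  let ?A = "\<lambda>n. {x\<in>{0..1}. \<bar>g x\<bar> > 1 / real (Suc n)}"
  assume "\<not> 0 < rearrangement g s"
  then have zero: "Inf ?S = 0"
    using rearrangement_nonneg[OF g s(1)] by (simp add: rearrangement_def)
  have le: "?m (?A n) \<le> s" for n
  proof -
    have "Inf ?S < 1 / real (Suc n)" unfolding zero by simp
    then obtain t where t: "t \<in> ?S" "t < 1 / real (Suc n)"
      using rearrangement_set_nonempty[OF g s(1)] by (meson cInf_lessD)
    have "?m (?A n) \<le> ?m {x\<in>{0..1}. \<bar>g x\<bar> > t}"
      using t(2) by (intro measure_superlevel_antimono[OF g]) simp
    then show ?thesis using t(1) by simp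
  qed
  have meas: "{x\<in>space (lebesgue_on {0..1}). \<bar>g x\<bar> > c} \<in> sets (lebesgue_on {0..1})" for c
    using g by measurable
  have "(\<lambda>n. ?m (?A n)) \<longlonglongrightarrow> ?m (\<Union>n. ?A n)"
  proof (intro finite_Lim_measure_incseq)
    show "range ?A \<subseteq> sets (lebesgue_on {0..1})" using meas by auto
    show "incseq ?A"
      unfolding incseq_def
    proof (intro allI impI subsetI)
      fix m n :: nat and x assume mn: "m \<le> n" and x: "x \<in> ?A m"
      have "1 / real (Suc n) \<le> 1 / real (Suc m)" using mn by (intro divide_left_mono) auto
      then show "x \<in> ?A n" using x by auto
    qed
  qed
  then have "?m (\<Union>n. ?A n) \<le> s" by (rule LIMSEQ_le_const2) (use le in blast)
  moreover have "(\<Union>n. ?A n) = {x\<in>{0..1}. \<bar>g x\<bar> > 0}"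
  proof (intro set_eqI iffI)
    fix x assume x: "x \<in> {x\<in>{0..1}. \<bar>g x\<bar> > 0}"
    then have "0 < \<bar>g x\<bar>" by simp
    then obtain n where "1 / real (Suc n) < \<bar>g x\<bar>" by (rule nat_approx_posE)
    then show "x \<in> (\<Union>n. ?A n)" using x by blast
  qed (auto elim: order.strict_trans[rotated])
  moreover have "?m {x\<in>{0..1}. \<bar>g x\<bar> > 0} = ?m (space (lebesgue_on {0..1}))"
    using pos meas[of 0] by (intro finite_measure_eq_AE) auto
  ultimately show False using s by (simp add: measure_restrict_space)
qed

lemma ennreal_inverse_antimono: "a \<le> b \<Longrightarrow> inverse b \<le> inverse (a :: ennreal)"
  unfolding less_eq_ennreal.rep_eq inverse_ennreal.rep_eq by (rule ereal_inverse_antimono) simp_all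

theorem theorem10:
  fixes \<Psi> g :: "real \<Rightarrow> real" and k :: "'n::finite" and w :: "real ^ 'n \<Rightarrow> real"
  assumes \<Psi>_nonneg: "\<And>x. x \<ge> 0 \<Longrightarrow> \<Psi> x \<ge> 0"
    and \<Psi>_convex: "convex_on {0..} \<Psi>"
    and \<Psi>_sqrt_concave: "concave_on {0..} (\<lambda>x. sqrt (\<Psi> x))"
    and \<Psi>_zero: "\<Psi> 0 = 0"
    and \<Psi>_C2: "C2_on {inv_into {0..} \<Psi> 1..} \<Psi>"
    and mu_prob: "prob_space (mu \<Psi>)"
    and g_meas: "g \<in> borel_measurable (lebesgue_on {0..1})"
    and g_nonneg: "\<And>s. s \<in> {0..1} \<Longrightarrow> g s \<ge> 0"
    and g_pos: "AE s in lebesgue_on {0..1}. g s > 0"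
    and g_sup: "(SUP t\<in>{0<..<1::real}. ennreal (rearrangement g t) *
        (ennreal (min t (1/2)) / isoperimetric_profile (mu \<Psi>) (ennreal (min t (1/2))))) < \<infinity>"
    and w_def: "\<And>x. w x = 1 / rearrangement g (H \<Psi> (x $ k))"
  shows "isoperimetric_weight (mu_prod \<Psi> :: (real ^ 'n) measure) w"
proof -
  interpret convex_potential \<Psi>
    using \<Psi>_nonneg \<Psi>_convex \<Psi>_sqrt_concave \<Psi>_zero mu_prob by (rule convex_potential.intro)
  interpret P: prob_space "mu_prod \<Psi> :: (real ^ 'n) measure" by (rule prob_space_mu_prod)
  let ?g = "rearrangement g"
  have H: "H \<Psi> u = tail (- u)" for u
    using measure_lessThan_minus[of "- u"] by (simp add: H_def)
  \<comment> \<open>The rearrangement is evaluated strictly inside \<open>(0, 1)\<close> only, where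
    it is meaningful and positive.\<close>
  have tail01: "0 < tail u" "tail u < 1" for u
    using tail_pos[of u] tail_pos[of "- u"] by (simp_all add: tail_minus)
  have gpos: "0 < ?g (tail u)" for u
    using tail01 by (intro rearrangement_pos[OF g_meas g_pos])
  have w: "w x = 1 / ?g (tail (- (x $ k)))" for x by (simp add: w_def H)
  have w_pos: "0 < w x" for x using gpos by (simp add: w)
  have w_meas: "w \<in> borel_measurable borel"
  proof -
    have "mono (\<lambda>u. 1 / ?g (tail (- u)))"
      using gpos tail_antimono tail_pos
      by (intro monoI divide_left_mono rearrangement_antimono[OF g_meas]) auto
    then have "(\<lambda>u. 1 / ?g (tail (- u))) \<in> borel_measurable borel" by (rule borel_measurable_mono)
    moreover have "(\<lambda>x :: real ^ 'n. x $ k) \<in> borel_measurable borel"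
      by (intro borel_measurable_continuous_onI continuous_intros)
    ultimately have "(\<lambda>x. 1 / ?g (tail (- (x $ k)))) \<in> borel_measurable borel"
      by (rule measurable_compose[rotated])
    then show ?thesis by (simp add: w[abs_def])
  qed
  define S where "S = (SUP t\<in>{0<..<1::real}. ennreal (?g t) *
        (ennreal (min t (1/2)) / isoperimetric_profile (mu \<Psi>) (ennreal (min t (1/2)))))"
  define G where "G = enn2real S"
  have SG: "S = ennreal G" using g_sup by (simp add: S_def[symmetric] G_def)
  have G0: "0 \<le> G" by (simp add: G_def)
  \<comment> \<open>The half-line bound on the profile at \<open>tail q\<close> gives
    \<open>t / I(t) \<ge> tail q / dens q = 1 / hazard q\<close> for levels up to
    \<open>1/2\<close>, which makes the supremum condition a bound on \<open>g\<close> by the hazard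
    rate.\<close>
  have g_le: "?g t \<le> G * hazard q" if t: "0 < t" "t < 1" and q: "0 \<le> q" "tail q = min t (1 / 2)" for t q
  proof -
    have "ennreal (?g t / hazard q) = ennreal (?g t) * (ennreal (tail q) / ennreal (dens q))"
      using rearrangement_nonneg[OF g_meas t(1)] hazard_pos[of q] tail_pos[of q]
      by (simp add: divide_ennreal dens_pos dens_eq_hazard flip: ennreal_mult)
    also have "\<dots> \<le> ennreal (?g t) * (ennreal (tail q) / isoperimetric_profile (mu \<Psi>) (ennreal (tail q)))"
      unfolding divide_ennreal_def
      by (intro mult_left_mono ennreal_inverse_antimono isoperimetric_profile_le q) auto
    also have "\<dots> \<le> S"
      unfolding S_def q(2) using t by (intro SUP_upper2[of t]) auto
    finally have "?g t / hazard q \<le> G" unfolding SG using G0 by (subst (asm) ennreal_le_iff) auto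
    then show ?thesis using hazard_pos[of q] by (simp add: divide_le_eq)
  qed
  obtain c where c: "0 < c" and
    prof: "\<And>y. 0 \<le> y \<Longrightarrow> ennreal (c * dens y) \<le> isoperimetric_profile (mu_prod \<Psi> :: (real ^ 'n) measure) (ennreal (tail y))"
    using isoperimetric_profile_product_ge by blast
  \<comment> \<open>The constant carries \<open>1 / c\<close> from the product profile and a factor
    2 from passing to half of the level below.\<close>
  have main: "m / isoperimetric_profile (mu_prod \<Psi> :: (real ^ 'n) measure) m \<le> ennreal (2 * G / c * r)"
    if r: "0 < r" and m_def: "m = min (emeasure (mu_prod \<Psi>) {x. w x \<le> r}) (1 / 2)" for r m
  proof (cases "m = 0")
    case False
    define M where "M = measure (mu_prod \<Psi>) {x. w x \<le> r}"
    define m' where "m' = min M (1 / 2)"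
    have half: "(1 / 2 :: ennreal) = ennreal (1 / 2)"
      by (simp add: divide_ennreal_def)
    have m: "m = ennreal m'"
      unfolding m_def half m'_def M_def by (simp add: P.emeasure_eq_measure min_def ennreal_le_iff del: ennreal_half)
    have "0 \<le> m'" by (simp add: m'_def M_def)
    then have m': "0 < m'" "m' \<le> 1 / 2" "m' \<le> M" using False m by (auto simp: m'_def le_less)
    obtain y where y: "0 \<le> y" "tail y = m'" using tail_surj[OF m'(1,2)] by blast
    obtain y2 where y2: "0 \<le> y2" "tail y2 = m' / 2" using tail_surj[of "m' / 2"] m' by auto
    \<comment> \<open>Otherwise \<open>{w \<le> r}\<close> would lie in a half-space of measure
      \<open>m' / 2\<close>, less than its own measure. Asking only for half of the level makes it
      unnecessary to find the boundary of \<open>{w \<le> r}\<close>.\<close>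
    have "\<exists>u. 1 / ?g (tail (- u)) \<le> r \<and> m' / 2 \<le> tail (- u)"
    proof (rule ccontr)
      assume none: "\<not> ?thesis"
      have "{x. w x \<le> r} \<subseteq> {x. x $ k \<in> {..<- y2}}"
      proof safe
        fix x assume "w x \<le> r"
        then have "1 / ?g (tail (- (x $ k))) \<le> r" by (simp add: w)
        then have "\<not> m' / 2 \<le> tail (- (x $ k))" using none by blast
        then have "tail (- (x $ k)) < tail y2" by (simp add: y2)
        then show "x $ k < - y2" by (simp add: tail_less_iff)
      qed
      moreover have "{x :: real ^ 'n. x $ k \<in> {..<- y2}} \<in> sets borel"
      proof -
        have "open {x :: real ^ 'n. x $ k < - y2}"
          by (intro open_Collect_less continuous_intros)
        then show ?thesis by simp
      qed
      ultimately have "ennreal M \<le> emeasure (mu_prod \<Psi>) {x :: real ^ 'n. x $ k \<in> {..<- y2}}"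
        unfolding M_def P.emeasure_eq_measure[symmetric] by (intro emeasure_mono) simp_all
      also have "\<dots> = ennreal (m' / 2)"
        unfolding emeasure_mu_prod_component[OF borel_open[OF open_lessThan]]
        by (simp add: emeasure_eq_measure measure_lessThan_minus y2)
      finally show False using m' by (simp add: ennreal_le_iff)
    qed
    then obtain u where u: "1 / ?g (tail (- u)) \<le> r" "m' / 2 \<le> tail (- u)" by blast
    define t where "t = tail (- u)"
    have t: "0 < t" "t < 1" using tail01 by (auto simp: t_def)
    have "0 < min t (1 / 2)" "min t (1 / 2) \<le> 1 / 2" using t by (simp, linarith)
    then obtain q where q: "0 \<le> q" "tail q = min t (1 / 2)" using tail_surj by blast
    have "tail y2 \<le> tail q" unfolding y2 q using u m' by (simp add: t_def)
    then have "q \<le> y2" by (simp only: tail_le_iff)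
    then have "hazard q \<le> hazard y2" using q by (intro hazard_mono)
    \<comment> \<open>From \<open>y\<close> to \<open>y2\<close> the tail is halved while the
      density does not grow.\<close>
    also have "\<dots> \<le> 2 * hazard y"
    proof -
      have "tail y2 \<le> tail y" using y y2 m' by simp
      then have "y \<le> y2" by (simp only: tail_le_iff)
      then have "dens y2 \<le> dens y" using y by (intro dens_antimono) simp
      then show ?thesis using m' by (simp add: hazard_def y y2 field_simps)
    qed
    finally have "G * hazard q \<le> G * (2 * hazard y)" using G0 by (rule mult_left_mono)
    then have "?g t \<le> 2 * G * hazard y" using g_le[OF t q] by simp
    moreover have "1 \<le> r * ?g t" using u(1) gpos[of "- u"] by (simp add: t_def field_simps)
    ultimately have "1 \<le> r * (2 * G * hazard y)" using r by (meson mult_left_mono less_imp_le order_trans)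
    then have bound: "1 / hazard y \<le> 2 * G * r" using hazard_pos[of y] by (simp add: field_simps)
    have "m / isoperimetric_profile (mu_prod \<Psi> :: (real ^ 'n) measure) m \<le> ennreal (tail y) / ennreal (c * dens y)"
      unfolding m y(2)[symmetric] divide_ennreal_def
      by (intro mult_left_mono ennreal_inverse_antimono prof y) auto
    also have "\<dots> = ennreal (1 / hazard y / c)"
      using c hazard_pos[of y] tail_pos[of y] by (simp add: divide_ennreal dens_pos dens_eq_hazard)
    also have "\<dots> \<le> ennreal (2 * G / c * r)"
      using divide_right_mono[OF bound, of c] c by (intro ennreal_leI) simp
    finally show ?thesis .
  qed simp
  show ?thesis
    unfolding isoperimetric_weight_def Let_def
  proof (intro conjI exI[of _ "2 * G / c"] allI impI)
    show "w \<in> borel_measurable (mu_prod \<Psi>)" using w_meas by simp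
    show "\<forall>x\<in>space (mu_prod \<Psi>). 0 \<le> w x" using w_pos by (simp add: less_imp_le)
    show "AE x in mu_prod \<Psi>. 0 < w x" using w_pos by simp
    fix r :: real assume "0 < r"
    let ?P = "mu_prod \<Psi> :: (real ^ 'n) measure"
    let ?m = "min (emeasure ?P {x \<in> space ?P. w x \<le> r}) (emeasure ?P (space ?P) / 2)"
    from main[OF \<open>0 < r\<close> refl]
    show "?m / isoperimetric_profile ?P ?m \<le> ennreal (2 * G / c * r)"
      using P.emeasure_space_1 by simp
  qed
qed

end
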